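(* Let $\mathbf{L}$ be a self-adjoint operator defined by left-definite theory on $L^2[(a,b),w]$, with domain $\mathcal{D}_{\mathbf L}$ (a restriction of the maximal domain $\mathcal{D}_{\max}$) that includes a complete orthogonal system of eigenfunctions of $\mathbf L$, enumerated as $\{P_k\}_{k=0}^\infty$. Furthermore, let $\mathbf L$ be an extension of the minimal (symmetric, closed) operator $\mathbf L_{\min}$ with domain $\mathcal D_{\min}$, where $\mathbf L$ and $\mathbf L_{\min}$ operate on their respective domains by $\ell[\,\cdot\,]$, and $\mathbf L_{\min}$ has deficiency indices $(m,m)$. Then the GKN conditions for the self-adjoint operator $\mathbf L$ are given by some $\{P_{k_1},\dots,P_{k_m}\}$; that is, there exist indices $k_1,\dots,k_m$ such that $P_{k_1},\dots,P_{k_m}$ are linearly independent modulo $\mathcal D_{\min}$, satisfy $[P_{k_i},P_{k_j}]|_a^b=0$ for all $i,j$, and $$\mathcal D_{\mathbf L}=\{f\in\mathcal D_{\max}: [f,P_{k_i}]|_a^b=0,\ i=1,\dots,m\}.$$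
   Context: $L^2[(a,b),w]$ has inner product $\langle f,g\rangle=\int_a^b f\overline g\,w\,dx$. A Sturm--Liouville expression is $\ell_0[f]=-\frac1w\left((pf')'+qf\right)$ with $p,w>0$ a.e. on $(a,b)$, $q$ real-valued, $1/p,q,w\in L^1_{\rm loc}(a,b)$. The expression $\ell$ is a composition power $\ell=\ell_0^n$ ($n\in\mathbb N$) of such an expression, of order $2n$, assumed to be a formally symmetric differential expression. Left-definite theory: if $\mathbf A$ is a self-adjoint operator in a Hilbert space $\mathcal H$ bounded below by $kI$, $k>0$, then for $r>0$ the $r$th left-definite space associated with $(\mathcal H,\mathbf A)$ is $\mathcal V_r=\mathcal D(\mathbf A^{r/2})$ with inner product $\langle x,y\rangle_r=\langle\mathbf A^{r/2}x,\mathbf A^{r/2}y\rangle$; in particular $\mathcal D(\mathbf A^n)=\mathcal V_{2n}$. (For operators merely bounded below one first applies a shift.) An operator "defined by left-definite theory" is one generated by composing a self-adjoint, bounded below differential operator $\mathbf A$ (acting by $\ell_0$) with itself: $\mathbf L=\mathbf A^n$, acting by $\ell=\ell_0^n$, with $\mathcal D_{\mathbf L}=\mathcal D(\mathbf A^n)=\mathcal V_{2n}$. $\mathcal{D}_{\max}=\{f:(a,b)\to\mathbb{C} : f^{(k)}\in AC_{\rm loc}(a,b),\ k=0,\dots,2n-1;\ f,\ell[f]\in L^2[(a,b),w]\}$. For $f,g\in\mathcal D_{\max}$, $[f,g]|_a^b=\int_a^b\{\ell[f]\overline g-\ell[\overline g]f\}w\,dx$. $\mathcal D_{\min}=\{f\in\mathcal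 D_{\max}:[f,g]|_a^b=0\ \forall g\in\mathcal D_{\max}\}$. The operators $\mathbf L_{\min}=\{\ell,\mathcal D_{\min}\}$ and $\mathbf L_{\max}=\{\ell,\mathcal D_{\max}\}$ are adjoints of one another. The deficiency indices of $\mathbf L_{\min}$ are $(\dim\mathcal D_+,\dim\mathcal D_-)$ with $\mathcal D_\pm=\{f\in\mathcal D_{\max}:\ell[f]=\pm if\}$. Functions $w_1,\dots,w_r\in\mathcal D_{\max}$ are linearly independent modulo $\mathcal D_{\min}$ if $\sum\alpha_iw_i\in\mathcal D_{\min}$ implies all $\alpha_i=0$. *)

theory Defs
  imports "HOL-Analysis.Analysis" "HOL-Library.Function_Algebras"
begin

type_synonym cfun = "real \<Rightarrow> complex"

subsection \<open>The space of square integrable functions with weight \<open>w\<close> on \<open>(a,b)\<close>\<close>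

text \<open>
  The end points may be infinite, \<open>(a,b)\<close> is \<^term>\<open>einterval a b\<close>. Elements of the Hilbert
  space are represented by functions; \<open>ae_eq\<close> is equality of the classes they represent.
\<close>

definition ae_eq :: "ereal \<Rightarrow> ereal \<Rightarrow> cfun \<Rightarrow> cfun \<Rightarrow> bool" where
  "ae_eq a b f g \<longleftrightarrow> (AE x in lebesgue. x \<in> einterval a b \<longrightarrow> f x = g x)"

definition L2 :: "ereal \<Rightarrow> ereal \<Rightarrow> (real \<Rightarrow> real) \<Rightarrow> cfun set" where
  "L2 a b w = {f. set_borel_measurable lebesgue (einterval a b) f \<and>
                  set_integrable lebesgue (einterval a b) (\<lambda>x. (cmod (f x))\<^sup>2 * w x)}"

definition L2_inner :: "ereal \<Rightarrow> ereal \<Rightarrow> (real \<Rightarrow> real) \<Rightarrow> cfun \<Rightarrow> cfun \<Rightarrow> complex" where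
  "L2_inner a b w f g = (LINT x=a..b|lebesgue. (f x * cnj (g x) * of_real (w x)))"

definition L2_norm :: "ereal \<Rightarrow> ereal \<Rightarrow> (real \<Rightarrow> real) \<Rightarrow> cfun \<Rightarrow> real" where
  "L2_norm a b w f = sqrt (Re (L2_inner a b w f f))"

subsection \<open>Operators in that space\<close>

text \<open>
  An unbounded operator is given by its graph, a set of pairs of square integrable functions
  that is invariant under changing both components on null sets. Powers of an operator
  (with the natural domain of a composition) are relational powers of its graph.
\<close>

definition op_of :: "ereal \<Rightarrow> ereal \<Rightarrow> (real \<Rightarrow> real) \<Rightarrow> (cfun \<Rightarrow> cfun) \<Rightarrow> cfun set \<Rightarrow> (cfun \<times> cfun) set"
  \<comment> \<open>the operator acting by \<open>T\<close> on the domain \<open>D\<close>\<close>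
  where
  "op_of a b w T D = {(f, g). f \<in> L2 a b w \<and> g \<in> L2 a b w \<and>
                              (\<exists>h\<in>D. ae_eq a b f h \<and> ae_eq a b g (T h))}"

definition densely_defined :: "ereal \<Rightarrow> ereal \<Rightarrow> (real \<Rightarrow> real) \<Rightarrow> (cfun \<times> cfun) set \<Rightarrow> bool" where
  "densely_defined a b w A \<longleftrightarrow>
     (\<forall>g \<in> L2 a b w. \<forall>e>0. \<exists>f \<in> Domain A. L2_norm a b w (\<lambda>x. f x - g x) < e)"

definition adjoint_op :: "ereal \<Rightarrow> ereal \<Rightarrow> (real \<Rightarrow> real) \<Rightarrow> (cfun \<times> cfun) set \<Rightarrow> (cfun \<times> cfun) set" where
  "adjoint_op a b w A = {(g, h). g \<in> L2 a b w \<and> h \<in> L2 a b w \<and>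
                           (\<forall>(f, f')\<in>A. L2_inner a b w f' g = L2_inner a b w f h)}"

definition self_adjoint_op :: "ereal \<Rightarrow> ereal \<Rightarrow> (real \<Rightarrow> real) \<Rightarrow> (cfun \<times> cfun) set \<Rightarrow> bool" where
  "self_adjoint_op a b w A \<longleftrightarrow> densely_defined a b w A \<and> adjoint_op a b w A = A"

definition bounded_below_op :: "ereal \<Rightarrow> ereal \<Rightarrow> (real \<Rightarrow> real) \<Rightarrow> (cfun \<times> cfun) set \<Rightarrow> bool" where
  "bounded_below_op a b w A \<longleftrightarrow>
     (\<exists>k::real. \<forall>(f, g)\<in>A. Re (L2_inner a b w g f) \<ge> k * Re (L2_inner a b w f f))"

subsection \<open>Absolute continuity\<close>

definition abs_cont_on :: "real \<Rightarrow> real \<Rightarrow> cfun \<Rightarrow> bool" where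
  "abs_cont_on c d f \<longleftrightarrow>
     (\<forall>e>0. \<exists>\<delta>>0. \<forall>D. finite D \<and> (\<forall>(s, t)\<in>D. c \<le> s \<and> s \<le> t \<and> t \<le> d) \<and>
         disjoint_family_on (\<lambda>(s, t). {s<..<t}) D \<and> (\<Sum>(s, t)\<in>D. t - s) < \<delta> \<longrightarrow>
         (\<Sum>(s, t)\<in>D. cmod (f t - f s)) < e)"

definition AC_loc :: "ereal \<Rightarrow> ereal \<Rightarrow> cfun set" where
  "AC_loc a b = {f. \<forall>c d. a < ereal c \<and> c \<le> d \<and> ereal d < b \<longrightarrow> abs_cont_on c d f}"

text \<open>
  The coefficients of a Sturm--Liouville expression are only given almost everywhere, so
  \<open>p f'\<close> being locally absolutely continuous means that it agrees almost everywhere with a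
  locally absolutely continuous function (which is unique on \<open>(a,b)\<close>); its derivative is that
  of this function.
\<close>

definition has_AC_version :: "ereal \<Rightarrow> ereal \<Rightarrow> cfun \<Rightarrow> bool" where
  "has_AC_version a b f \<longleftrightarrow> (\<exists>v \<in> AC_loc a b. ae_eq a b f v)"

definition AC_version :: "ereal \<Rightarrow> ereal \<Rightarrow> cfun \<Rightarrow> cfun" where
  "AC_version a b f = (SOME v. v \<in> AC_loc a b \<and> ae_eq a b f v)"

definition AC_deriv :: "ereal \<Rightarrow> ereal \<Rightarrow> cfun \<Rightarrow> cfun" where
  "AC_deriv a b f = (\<lambda>x. vector_derivative (AC_version a b f) (at x))"

subsection \<open>Sturm--Liouville expressions and their powers\<close>

definition L1_loc :: "ereal \<Rightarrow> ereal \<Rightarrow> (real \<Rightarrow> real) set" where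
  "L1_loc a b = {f. \<forall>c d. a < ereal c \<and> c \<le> d \<and> ereal d < b \<longrightarrow> f absolutely_integrable_on {c..d}}"

definition sl_coefficients ::
  "ereal \<Rightarrow> ereal \<Rightarrow> (real \<Rightarrow> real) \<Rightarrow> (real \<Rightarrow> real) \<Rightarrow> (real \<Rightarrow> real) \<Rightarrow> bool" where
  "sl_coefficients a b p q w \<longleftrightarrow>
     (AE x in lebesgue. x \<in> einterval a b \<longrightarrow> p x > 0 \<and> w x > 0) \<and>
     (\<lambda>x. 1 / p x) \<in> L1_loc a b \<and> q \<in> L1_loc a b \<and> w \<in> L1_loc a b"

definition sl_expr ::
  "ereal \<Rightarrow> ereal \<Rightarrow> (real \<Rightarrow> real) \<Rightarrow> (real \<Rightarrow> real) \<Rightarrow> (real \<Rightarrow> real) \<Rightarrow> cfun \<Rightarrow> cfun" where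
  "sl_expr a b p q w f =
     (\<lambda>x. - (1 / of_real (w x)) *
            (AC_deriv a b (\<lambda>t. of_real (p t) * AC_deriv a b f t) x + of_real (q x) * f x))"

definition sl_pow ::
  "ereal \<Rightarrow> ereal \<Rightarrow> (real \<Rightarrow> real) \<Rightarrow> (real \<Rightarrow> real) \<Rightarrow> (real \<Rightarrow> real) \<Rightarrow> nat \<Rightarrow> cfun \<Rightarrow> cfun" where
  "sl_pow a b p q w n = sl_expr a b p q w ^^ n"

text \<open>
  \<open>sl_pow_defined\<close> says that all derivatives occurring in the \<open>n\<close>-fold composition make sense
  almost everywhere. It follows from \<open>AC_derivs\<close> below (with \<open>2 * n\<close>) if the coefficients are
  smooth enough and \<open>w > 0\<close>.
\<close>

definition sl_pow_defined ::
  "ereal \<Rightarrow> ereal \<Rightarrow> (real \<Rightarrow> real) \<Rightarrow> (real \<Rightarrow> real) \<Rightarrow> (real \<Rightarrow> real) \<Rightarrow> nat \<Rightarrow> cfun \<Rightarrow> bool" where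
  "sl_pow_defined a b p q w n f \<longleftrightarrow>
     (\<forall>j<n. has_AC_version a b (sl_pow a b p q w j f) \<and>
            has_AC_version a b (\<lambda>t. of_real (p t) * AC_deriv a b (sl_pow a b p q w j f) t))"

definition nderiv :: "nat \<Rightarrow> cfun \<Rightarrow> cfun" where
  "nderiv k = (\<lambda>f x. vector_derivative f (at x)) ^^ k"

text \<open>The derivatives of order \<open>0, \<dots>, r - 1\<close> exist on \<open>(a,b)\<close> and are in \<open>AC_loc\<close>.\<close>

definition AC_derivs :: "ereal \<Rightarrow> ereal \<Rightarrow> nat \<Rightarrow> cfun \<Rightarrow> bool" where
  "AC_derivs a b r f \<longleftrightarrow>
     (\<forall>k. Suc k < r \<longrightarrow> (\<forall>x \<in> einterval a b. nderiv k f differentiable at x)) \<and>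
     (\<forall>k<r. nderiv k f \<in> AC_loc a b)"

text \<open>
  A function \<open>(a,b) \<rightarrow> \<complex>\<close> is represented by the total function extending it by zero. Thus
  members of \<open>sl_dom\<close> that agree almost everywhere on \<open>(a,b)\<close> are equal.
\<close>

definition sl_dom ::
  "ereal \<Rightarrow> ereal \<Rightarrow> (real \<Rightarrow> real) \<Rightarrow> (real \<Rightarrow> real) \<Rightarrow> (real \<Rightarrow> real) \<Rightarrow> nat \<Rightarrow> cfun set" where
  "sl_dom a b p q w n = {f. (\<forall>x. x \<notin> einterval a b \<longrightarrow> f x = 0) \<and>
                            AC_derivs a b (2 * n) f \<and> sl_pow_defined a b p q w n f}"

definition compactly_supported :: "ereal \<Rightarrow> ereal \<Rightarrow> cfun \<Rightarrow> bool" where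
  "compactly_supported a b f \<longleftrightarrow>
     (\<exists>c d. a < ereal c \<and> c \<le> d \<and> ereal d < b \<and> (\<forall>x. x \<notin> {c..d} \<longrightarrow> f x = 0))"

text \<open>The expression coincides with its formal (Lagrange) adjoint, tested on compactly supported functions.\<close>

definition formally_symmetric ::
  "ereal \<Rightarrow> ereal \<Rightarrow> (real \<Rightarrow> real) \<Rightarrow> (real \<Rightarrow> real) \<Rightarrow> (real \<Rightarrow> real) \<Rightarrow> nat \<Rightarrow> bool" where
  "formally_symmetric a b p q w n \<longleftrightarrow>
     (\<forall>f \<in> sl_dom a b p q w n. \<forall>g \<in> sl_dom a b p q w n.
        compactly_supported a b f \<and> compactly_supported a b g \<longrightarrow>
        L2_inner a b w (sl_pow a b p q w n f) g = L2_inner a b w f (sl_pow a b p q w n g))"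

definition D_max ::
  "ereal \<Rightarrow> ereal \<Rightarrow> (real \<Rightarrow> real) \<Rightarrow> (real \<Rightarrow> real) \<Rightarrow> (real \<Rightarrow> real) \<Rightarrow> nat \<Rightarrow> cfun set" where
  "D_max a b p q w n = {f \<in> sl_dom a b p q w n. f \<in> L2 a b w \<and> sl_pow a b p q w n f \<in> L2 a b w}"

definition sl_bracket ::
  "ereal \<Rightarrow> ereal \<Rightarrow> (real \<Rightarrow> real) \<Rightarrow> (real \<Rightarrow> real) \<Rightarrow> (real \<Rightarrow> real) \<Rightarrow> nat \<Rightarrow> cfun \<Rightarrow> cfun \<Rightarrow> complex" where
  "sl_bracket a b p q w n f g =
     (LINT x=a..b|lebesgue. ((sl_pow a b p q w n f x * cnj (g x)
                             - sl_pow a b p q w n (\<lambda>t. cnj (g t)) x * f x) * of_real (w x)))"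

definition D_min ::
  "ereal \<Rightarrow> ereal \<Rightarrow> (real \<Rightarrow> real) \<Rightarrow> (real \<Rightarrow> real) \<Rightarrow> (real \<Rightarrow> real) \<Rightarrow> nat \<Rightarrow> cfun set" where
  "D_min a b p q w n =
     {f \<in> D_max a b p q w n. \<forall>g \<in> D_max a b p q w n. sl_bracket a b p q w n f g = 0}"

subsection \<open>Deficiency indices and linear independence modulo the minimal domain\<close>

global_interpretation cfun: vector_space "\<lambda>(c::complex) (f::cfun) x. c * f x"
  by unfold_locales (auto simp: fun_eq_iff algebra_simps)

definition has_cdim :: "cfun set \<Rightarrow> nat \<Rightarrow> bool" where
  "has_cdim V m \<longleftrightarrow> (\<exists>B. finite B \<and> card B = m \<and> cfun.independent B \<and> cfun.span B = V)"

definition deficiency_space ::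
  "ereal \<Rightarrow> ereal \<Rightarrow> (real \<Rightarrow> real) \<Rightarrow> (real \<Rightarrow> real) \<Rightarrow> (real \<Rightarrow> real) \<Rightarrow> nat \<Rightarrow> complex \<Rightarrow> cfun set" where
  "deficiency_space a b p q w n z =
     {f \<in> D_max a b p q w n. ae_eq a b (sl_pow a b p q w n f) (\<lambda>x. z * f x)}"

definition deficiency_indices ::
  "ereal \<Rightarrow> ereal \<Rightarrow> (real \<Rightarrow> real) \<Rightarrow> (real \<Rightarrow> real) \<Rightarrow> (real \<Rightarrow> real) \<Rightarrow> nat \<Rightarrow> nat \<Rightarrow> nat \<Rightarrow> bool" where
  "deficiency_indices a b p q w n r s \<longleftrightarrow>
     has_cdim (deficiency_space a b p q w n \<i>) r \<and> has_cdim (deficiency_space a b p q w n (- \<i>)) s"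

definition lin_indep_mod :: "cfun set \<Rightarrow> nat \<Rightarrow> (nat \<Rightarrow> cfun) \<Rightarrow> bool" where
  "lin_indep_mod D m v \<longleftrightarrow>
     (\<forall>\<alpha>::nat \<Rightarrow> complex. (\<lambda>x. \<Sum>i=1..m. \<alpha> i * v i x) \<in> D \<longrightarrow> (\<forall>i\<in>{1..m}. \<alpha> i = 0))"

subsection \<open>Left-definite operators and complete systems of eigenfunctions\<close>

text \<open>
  An operator defined by left-definite theory is a power \<open>A\<^sup>n\<close> of a self-adjoint, bounded below
  operator \<open>A\<close> that acts by the Sturm--Liouville expression. Its domain is the left-definite
  space of index \<open>2 n\<close> because \<open>A\<close> to the power \<open>2 n / 2\<close> is \<open>A\<^sup>n\<close>.
\<close>

definition left_definite_op ::
  "ereal \<Rightarrow> ereal \<Rightarrow> (real \<Rightarrow> real) \<Rightarrow> (real \<Rightarrow> real) \<Rightarrow> (real \<Rightarrow> real) \<Rightarrow> nat \<Rightarrow> (cfun \<times> cfun) set \<Rightarrow> bool" where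
  "left_definite_op a b p q w n L \<longleftrightarrow>
     (\<exists>A. self_adjoint_op a b w A \<and> bounded_below_op a b w A \<and>
          A \<subseteq> op_of a b w (sl_expr a b p q w) {f. sl_pow_defined a b p q w 1 f} \<and>
          L = A ^^ n)"

definition complete_orthogonal :: "ereal \<Rightarrow> ereal \<Rightarrow> (real \<Rightarrow> real) \<Rightarrow> (nat \<Rightarrow> cfun) \<Rightarrow> bool" where
  "complete_orthogonal a b w P \<longleftrightarrow>
     (\<forall>k. P k \<in> L2 a b w \<and> \<not> ae_eq a b (P k) (\<lambda>x. 0)) \<and>
     (\<forall>j k. j \<noteq> k \<longrightarrow> L2_inner a b w (P j) (P k) = 0) \<and>
     (\<forall>f \<in> L2 a b w. (\<forall>k. L2_inner a b w f (P k) = 0) \<longrightarrow> ae_eq a b f (\<lambda>x. 0))"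

end

theory Submission
  imports Defs
begin

text \<open>
  Write \<open>[f,g]\<close> for the boundary form, \<open>\<ell>\<close> for the expression and \<open>N\<close> for the deficiency space
  \<open>{g \<in> D_max. \<ell>[g] = \<i> g}\<close>, of dimension \<open>m\<close>. The eigenfunctions are sifted by the functionals
  \<open>g \<mapsto> [g, P k]\<close> on \<open>N\<close>. Since \<open>[g, P k] = (\<i> - c k) \<langle>g, P k\<rangle>\<close> for an eigenvalue \<open>c k\<close>, which is
  real, and since the \<open>P k\<close> are complete, these functionals have no common zero except \<open>0\<close>
  (\<open>deficiency_separated\<close>). Functionals with that property on an \<open>m\<close>-dimensional space contain
  \<open>m\<close> linearly independent ones, which still separate points (\<open>separating_functionals_select\<close>);
  their indices are the wanted ones.

  Independence of the functionals on \<open>N \<subseteq> D_max\<close> gives independence of the selected eigenfunctions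
  modulo \<open>D_min\<close>, because elements of \<open>D_min\<close> are annihilated by every \<open>[\<cdot>, g]\<close>. The form vanishes
  on the domain of a symmetric operator, which gives \<open>[P i, P j] = 0\<close> and one inclusion of the
  domain formula. For the other one, \<open>D_max = D_L + N\<close> (\<open>Dom_decomposition\<close>): if \<open>f = h + g\<close>
  accordingly satisfies the boundary conditions, then so does \<open>g\<close>, and \<open>g = 0\<close> because the selected
  functionals separate points of \<open>N\<close>.

  The decomposition says that \<open>L - \<i>\<close> is onto (\<open>resolvent\<close>). The solution of \<open>(L - \<i>) h = u\<close> is
  the series of the \<open>\<langle>u, P k\<rangle> / (c k - \<i>)\<close>, which converges by the Riesz-Fischer theorem, and its
  sum lies in the domain because \<open>L\<close> equals its adjoint.

  All of this presupposes that \<open>f \<mapsto> \<ell>[f]\<close> is linear and commutes with conjugation almost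
  everywhere. At a point where an absolutely continuous function is not differentiable, the
  derivative occurring in \<open>\<ell>\<close> is an arbitrary value on which nothing is known, so linearity rests
  on the theorem of Lebesgue that absolutely continuous functions are differentiable almost
  everywhere. It is derived from the case of monotone functions, by Vitali's covering theorem.
\<close>

section \<open>Monotone functions are differentiable almost everywhere\<close>

definition around_at_all_scales :: "(real \<Rightarrow> real \<Rightarrow> bool) \<Rightarrow> real \<Rightarrow> bool" where
  "around_at_all_scales Q x \<longleftrightarrow> (\<forall>e>0. \<exists>s t. s \<le> x \<and> x \<le> t \<and> s < t \<and> t - s < e \<and> Q s t)"

text \<open>
  Vitali's covering theorem for closed intervals that need not be centred at the points to be
  covered, indexed by their pairs of end points.
\<close>
lemma Vitali_intervals:
  assumes E: "\<And>x. x \<in> E \<Longrightarrow> around_at_all_scales Q x"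
  obtains C :: "(real \<times> real) set" where "countable C" "\<And>s t. (s, t) \<in> C \<Longrightarrow> s < t \<and> Q s t"
    "disjoint_family_on (\<lambda>(s, t). {s..t}) C" "negligible (E - (\<Union>(s, t)\<in>C. {s..t}))"
proof -
  define K where "K = {(s, t). s < t \<and> Q s t}"
  define mid rad :: "real \<times> real \<Rightarrow> real"
    where "mid = (\<lambda>(s, t). (s + t) / 2)" and "rad = (\<lambda>(s, t). (t - s) / 2)"
  have ball: "cball (mid i) (rad i) = (\<lambda>(s, t). {s..t}) i" for i
    by (cases i) (auto simp: mid_def rad_def cball_eq_atLeastAtMost field_simps)
  have "0 < rad i" if "i \<in> K" for i
    using that by (auto simp: K_def rad_def)
  moreover have "\<exists>i. i \<in> K \<and> x \<in> cball (mid i) (rad i) \<and> rad i < e" if x: "x \<in> E" and e: "0 < e" for x e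
  proof -
    from E[OF x] e obtain s t where st: "s \<le> x" "x \<le> t" "s < t" "t - s < e" "Q s t"
      unfolding around_at_all_scales_def by blast
    show ?thesis
      unfolding ball using st by (intro exI[of _ "(s, t)"]) (auto simp: K_def rad_def)
  qed
  ultimately obtain C where C: "countable C" "C \<subseteq> K"
    "pairwise (\<lambda>i j. disjnt (cball (mid i) (rad i)) (cball (mid j) (rad j))) C"
    "negligible (E - (\<Union>i \<in> C. cball (mid i) (rad i)))"
    by (rule Vitali_covering_theorem_cballs)
  show thesis
  proof (rule that[of C])
    show "disjoint_family_on (\<lambda>(s, t). {s..t}) C"
      using C(3) unfolding ball by (auto simp: disjoint_family_on_def pairwise_def disjnt_def)
    show "negligible (E - (\<Union>(s, t)\<in>C. {s..t}))"
      using C(4) unfolding ball by simp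
  qed (use C in \<open>auto simp: K_def\<close>)
qed

lemma emeasure_intervals:
  assumes "countable C" "\<And>s t. (s, t) \<in> C \<Longrightarrow> s < t" "disjoint_family_on (\<lambda>(s, t). {s..t}) C"
  shows "emeasure lebesgue (\<Union>(s, t)\<in>C. {s..t}) = (\<integral>\<^sup>+i. ennreal (snd i - fst i) \<partial>count_space C)"
proof -
  have "emeasure lebesgue (\<Union>(s, t)\<in>C. {s..t})
        = (\<integral>\<^sup>+i. emeasure lebesgue ((\<lambda>(s, t). {s..t}) i) \<partial>count_space C)"
    using assms by (intro emeasure_UN_countable) auto
  also have "\<dots> = (\<integral>\<^sup>+i. ennreal (snd i - fst i) \<partial>count_space C)"
    using assms(2) by (intro nn_integral_cong) (force simp: less_imp_le)
  finally show ?thesis .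
qed

text \<open>
  A monotone function maps disjoint intervals into disjoint ones, so the increments over a disjoint
  family are the lengths of disjoint open intervals. Sums of increments are thereby turned into the
  measure of a union, and the increments of a family inside another one are compared by monotonicity
  of measure.
\<close>
lemma emeasure_image_intervals:
  fixes f :: "real \<Rightarrow> real"
  assumes f: "mono_on {c..d} f" and C: "countable C" "disjoint_family_on (\<lambda>(s, t). {s..t}) C"
    and st: "\<And>s t. (s, t) \<in> C \<Longrightarrow> s < t \<and> c \<le> s \<and> t \<le> d"
  shows "emeasure lebesgue (\<Union>(s, t)\<in>C. {f s<..<f t}) = (\<integral>\<^sup>+i. ennreal (f (snd i) - f (fst i)) \<partial>count_space C)"
proof -
  have "disjoint_family_on (\<lambda>(s, t). {f s<..<f t}) C"
    unfolding disjoint_family_on_def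
  proof (intro ballI impI)
    fix i j assume ij: "i \<in> C" "j \<in> C" and "i \<noteq> j"
    obtain s t s' t' where eq: "i = (s, t)" "j = (s', t')" by (cases i, cases j)
    with ij \<open>i \<noteq> j\<close> have i: "(s, t) \<in> C" "(s', t') \<in> C" and ne: "(s, t) \<noteq> (s', t')" by auto
    have "{s..t} \<inter> {s'..t'} = {}"
      using C(2) i ne by (fastforce simp: disjoint_family_on_def)
    then have "t < s' \<or> t' < s"
      using st[OF i(1)] st[OF i(2)] by (simp add: max_def min_def split: if_splits)
    then have "f t \<le> f s' \<or> f t' \<le> f s"
      using st[OF i(1)] st[OF i(2)] by (auto intro!: mono_onD[OF f])
    then show "(case i of (s, t) \<Rightarrow> {f s<..<f t}) \<inter> (case j of (s, t) \<Rightarrow> {f s<..<f t}) = {}"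
      by (auto simp: eq)
  qed
  then have "emeasure lebesgue (\<Union>(s, t)\<in>C. {f s<..<f t})
        = (\<integral>\<^sup>+i. emeasure lebesgue ((\<lambda>(s, t). {f s<..<f t}) i) \<partial>count_space C)"
    using C by (intro emeasure_UN_countable) auto
  also have "\<dots> = (\<integral>\<^sup>+i. ennreal (f (snd i) - f (fst i)) \<partial>count_space C)"
  proof (intro nn_integral_cong)
    fix i assume "i \<in> space (count_space C)"
    then have i: "(fst i, snd i) \<in> C" by simp
    have "f (fst i) \<le> f (snd i)"
      using st[OF i] by (intro mono_onD[OF f]; simp)
    then show "emeasure lebesgue ((\<lambda>(s, t). {f s<..<f t}) i) = ennreal (f (snd i) - f (fst i))"
      by (simp add: case_prod_beta)
  qed
  finally show ?thesis .
qed

abbreviation "flat f u s t \<equiv> f t - f s < u * (t - s)"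
abbreviation "steep f v s t \<equiv> f t - f s > v * (t - s)"

lemma emeasure_image_flat:
  fixes f :: "real \<Rightarrow> real"
  assumes f: "mono_on {c..d} f" and C: "countable C" "disjoint_family_on (\<lambda>(s, t). {s..t}) C"
    and st: "\<And>s t. (s, t) \<in> C \<Longrightarrow> s < t \<and> c \<le> s \<and> t \<le> d" and u: "0 \<le> u"
    and fl: "\<And>s t. (s, t) \<in> C \<Longrightarrow> flat f u s t"
  shows "emeasure lebesgue (\<Union>(s, t)\<in>C. {f s<..<f t}) \<le> ennreal u * emeasure lebesgue (\<Union>(s, t)\<in>C. {s..t})"
proof -
  have "emeasure lebesgue (\<Union>(s, t)\<in>C. {f s<..<f t}) = (\<integral>\<^sup>+i. ennreal (f (snd i) - f (fst i)) \<partial>count_space C)"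
    by (rule emeasure_image_intervals[OF f C st])
  also have "\<dots> \<le> (\<integral>\<^sup>+i. ennreal u * ennreal (snd i - fst i) \<partial>count_space C)"
  proof (intro nn_integral_mono)
    fix i assume "i \<in> space (count_space C)"
    then have "(fst i, snd i) \<in> C" by simp
    from fl[OF this] st[OF this] u show "ennreal (f (snd i) - f (fst i)) \<le> ennreal u * ennreal (snd i - fst i)"
      by (auto simp: ennreal_mult[symmetric] intro!: ennreal_leI)
  qed
  also have "\<dots> = ennreal u * emeasure lebesgue (\<Union>(s, t)\<in>C. {s..t})"
    using st C by (subst emeasure_intervals) (auto simp: nn_integral_cmult)
  finally show ?thesis .
qed

lemma emeasure_image_steep:
  fixes f :: "real \<Rightarrow> real"
  assumes f: "mono_on {c..d} f" and C: "countable C" "disjoint_family_on (\<lambda>(s, t). {s..t}) C"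
    and st: "\<And>s t. (s, t) \<in> C \<Longrightarrow> s < t \<and> c \<le> s \<and> t \<le> d" and v: "0 \<le> v"
    and fl: "\<And>s t. (s, t) \<in> C \<Longrightarrow> steep f v s t"
  shows "ennreal v * emeasure lebesgue (\<Union>(s, t)\<in>C. {s..t}) \<le> emeasure lebesgue (\<Union>(s, t)\<in>C. {f s<..<f t})"
proof -
  have "ennreal v * emeasure lebesgue (\<Union>(s, t)\<in>C. {s..t}) = (\<integral>\<^sup>+i. ennreal v * ennreal (snd i - fst i) \<partial>count_space C)"
    using st C by (subst emeasure_intervals) (auto simp: nn_integral_cmult)
  also have "\<dots> \<le> (\<integral>\<^sup>+i. ennreal (f (snd i) - f (fst i)) \<partial>count_space C)"
  proof (intro nn_integral_mono)
    fix i assume "i \<in> space (count_space C)"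
    then have "(fst i, snd i) \<in> C" by simp
    from fl[OF this] st[OF this] v show "ennreal v * ennreal (snd i - fst i) \<le> ennreal (f (snd i) - f (fst i))"
      by (auto simp: ennreal_mult[symmetric] intro!: ennreal_leI)
  qed
  also have "\<dots> = emeasure lebesgue (\<Union>(s, t)\<in>C. {f s<..<f t})"
    by (rule emeasure_image_intervals[OF f C st, symmetric])
  finally show ?thesis .
qed

text \<open>
  The sets whose negligibility is shown below are not known to be measurable; they are estimated
  through measurable supersets, here a Vitali family together with the null set that it misses.
\<close>
lemma measurable_superset_of_cover:
  assumes C: "countable C" and neg: "negligible (E - (\<Union>(s, t)\<in>C. {s..t}))" and "0 \<le> B"
    and B: "emeasure lebesgue (\<Union>(s::real, t)\<in>C. {s..t}) \<le> ennreal B"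
  obtains T where "T \<in> lmeasurable" "E \<subseteq> T" "measure lebesgue T \<le> B"
proof -
  let ?U = "\<Union>(s, t)\<in>C. {s..t}"
  have U: "?U \<in> sets lebesgue"
    using C by (intro sets.countable_UN') auto
  then have Um: "?U \<in> lmeasurable"
    using B by (intro fmeasurableI) (auto simp: le_less_trans)
  have "measure lebesgue (?U \<union> (E - ?U)) = measure lebesgue ?U"
    using neg Um by (intro measure_Un_null_set) (auto simp: negligible_iff_null_sets U)
  moreover have "measure lebesgue ?U \<le> B"
    using B \<open>0 \<le> B\<close> by (simp add: measure_def enn2real_leI)
  moreover have "?U \<union> (E - ?U) \<in> lmeasurable"
    using Um negligible_imp_measurable[OF neg] by (rule fmeasurable.Un)
  ultimately show thesis
    by (intro that[of "?U \<union> (E - ?U)"]) auto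
qed

text \<open>
  A disjoint family of intervals with difference quotients above \<open>v\<close> has total length at most
  \<open>(f d - f c) / v\<close>, which is as small as desired.
\<close>
lemma negligible_steep:
  fixes f :: "real \<Rightarrow> real"
  assumes f: "mono_on {c..d} f" and E: "E \<subseteq> {c<..<d}"
    and st: "\<And>x v. x \<in> E \<Longrightarrow> around_at_all_scales (steep f v) x"
  shows "negligible E"
  unfolding negligible_outer_le
proof (intro allI impI)
  fix e :: real assume e: "e > 0"
  \<comment> \<open>Chosen such that the total increment is at most \<open>v * e\<close>; the \<open>1\<close> keeps \<open>v\<close> positive.\<close>
  define v where "v = \<bar>f d - f c\<bar> / e + 1"
  have v: "v > 0" using e unfolding v_def by (smt (verit) divide_nonneg_pos)
  have "around_at_all_scales (\<lambda>s t. c \<le> s \<and> t \<le> d \<and> steep f v s t) x" if x: "x \<in> E" for x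
    unfolding around_at_all_scales_def
  proof (intro allI impI)
    fix e' :: real assume "e' > 0"
    moreover have "c < x" "x < d" using E x by auto
    ultimately have "min e' (min (x - c) (d - x)) > 0" by auto
    with st[OF x, of v] obtain s t where "s \<le> x" "x \<le> t" "s < t" "t - s < min e' (min (x - c) (d - x))" "steep f v s t"
      unfolding around_at_all_scales_def by blast
    then show "\<exists>s t. s \<le> x \<and> x \<le> t \<and> s < t \<and> t - s < e' \<and> c \<le> s \<and> t \<le> d \<and> steep f v s t"
      by (intro exI[of _ s] exI[of _ t]) auto
  qed
  then obtain C where C: "countable C" and Cst: "\<And>s t. (s, t) \<in> C \<Longrightarrow> s < t \<and> c \<le> s \<and> t \<le> d \<and> steep f v s t"
    and dis: "disjoint_family_on (\<lambda>(s, t). {s..t}) C" and neg: "negligible (E - (\<Union>(s, t)\<in>C. {s..t}))"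
    by (rule Vitali_intervals) blast+
  let ?U = "\<Union>(s, t)\<in>C. {s..t}"
  have "ennreal v * emeasure lebesgue ?U \<le> emeasure lebesgue (\<Union>(s, t)\<in>C. {f s<..<f t})"
    using Cst v by (intro emeasure_image_steep[OF f C dis]) auto
  also have "\<dots> \<le> emeasure lebesgue {f c<..<f d}"
  proof (intro emeasure_mono)
    show "(\<Union>(s, t)\<in>C. {f s<..<f t}) \<subseteq> {f c<..<f d}"
    proof clarify
      fix x s t assume i: "(s, t) \<in> C" and x: "x \<in> {f s<..<f t}"
      have "f c \<le> f s" "f t \<le> f d" using Cst[OF i] by (auto intro!: mono_onD[OF f])
      with x show "x \<in> {f c<..<f d}" by auto
    qed
  qed auto
  also have "\<dots> \<le> ennreal \<bar>f d - f c\<bar>"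
    by (cases "f c \<le> f d") auto
  also have "\<dots> \<le> ennreal (v * e)"
    using e by (intro ennreal_leI) (auto simp: v_def field_simps)
  also have "\<dots> = ennreal v * ennreal e"
    using v e by (simp add: ennreal_mult)
  finally have "emeasure lebesgue ?U \<le> ennreal e"
    using v by (subst (asm) ennreal_mult_le_mult_iff) auto
  from measurable_superset_of_cover[OF C neg _ this] e
  show "\<exists>T. E \<subseteq> T \<and> T \<in> lmeasurable \<and> measure lebesgue T \<le> e"
    by (metis less_imp_le)
qed

text \<open>
  Let \<open>\<alpha>\<close> be the outer measure of \<open>E\<close>. Cover almost all of \<open>E\<close> by disjoint flat intervals inside an open set \<open>G\<close>
  of measure close to \<open>\<alpha>\<close>; the increments over them sum to at most \<open>u\<close> times the measure of \<open>G\<close>.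
  Then cover almost all of \<open>E\<close> again by disjoint steep intervals inside the flat ones. Their total
  length is at least \<open>\<alpha>\<close>, so their increments sum to at least \<open>v * \<alpha>\<close>. Hence \<open>v * \<alpha> \<le> u * \<alpha>\<close>.
\<close>
lemma negligible_flat_steep:
  fixes f :: "real \<Rightarrow> real"
  assumes f: "mono_on {c..d} f" and E: "E \<subseteq> {c<..<d}" and uv: "0 \<le> u" "u < v"
    and fl: "\<And>x. x \<in> E \<Longrightarrow> around_at_all_scales (flat f u) x" and st: "\<And>x. x \<in> E \<Longrightarrow> around_at_all_scales (steep f v) x"
  shows "negligible E"
proof -
  define \<T> where "\<T> = {T \<in> lmeasurable. E \<subseteq> T}"
  define \<alpha> where "\<alpha> = (INF T\<in>\<T>. measure lebesgue T)"
  have ne: "\<T> \<noteq> {}"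
    using E by (auto simp: \<T>_def intro!: exI[of _ "{c<..<d}"])
  have bdd: "bdd_below (measure lebesgue ` \<T>)"
    by (auto intro!: bdd_belowI[of _ 0])
  have contract: "\<alpha> \<le> u / v * (measure lebesgue T + e)" if T: "T \<in> \<T>" and e: "e > 0" for T e
  proof -
    from T have Tm: "T \<in> lmeasurable" and ET: "E \<subseteq> T" by (auto simp: \<T>_def)
    from sets_lebesgue_outer_open[OF fmeasurableD[OF Tm] e] obtain G
      where G: "open G" "T \<subseteq> G" "G - T \<in> lmeasurable" "emeasure lebesgue (G - T) < ennreal e" by blast
    have "emeasure lebesgue G \<le> emeasure lebesgue T + emeasure lebesgue (G - T)"
      using Tm G by (metis Diff_disjoint Un_Diff_cancel emeasure_subadditive fmeasurableD sup.absorb2)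
    also have "\<dots> \<le> ennreal (measure lebesgue T) + ennreal e"
      using G Tm by (intro add_mono) (auto simp: emeasure_eq_measure2)
    finally have Gm: "emeasure lebesgue G \<le> ennreal (measure lebesgue T + e)"
      using e by (simp add: ennreal_plus)
    have "around_at_all_scales (\<lambda>s t. {s..t} \<subseteq> G \<and> c \<le> s \<and> t \<le> d \<and> flat f u s t) x" if x: "x \<in> E" for x
      unfolding around_at_all_scales_def
    proof (intro allI impI)
      fix e' :: real assume "e' > 0"
      moreover have "c < x" "x < d" using E x by auto
      moreover obtain r where r: "r > 0" "ball x r \<subseteq> G"
        using G x ET by (meson open_contains_ball subsetD)
      ultimately have "min (min r e') (min (x - c) (d - x)) > 0" by auto
      with fl[OF x] obtain s t where "s \<le> x" "x \<le> t" "s < t" "t - s < min (min r e') (min (x - c) (d - x))" "flat f u s t"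
        unfolding around_at_all_scales_def by blast
      moreover from this have "{s..t} \<subseteq> ball x r" by (auto simp: dist_real_def)
      ultimately show "\<exists>s t. s \<le> x \<and> x \<le> t \<and> s < t \<and> t - s < e' \<and> {s..t} \<subseteq> G \<and> c \<le> s \<and> t \<le> d \<and> flat f u s t"
        using r(2) by (intro exI[of _ s] exI[of _ t]) auto
    qed
    then obtain C where C: "countable C"
      and Cst: "\<And>s t. (s, t) \<in> C \<Longrightarrow> s < t \<and> {s..t} \<subseteq> G \<and> c \<le> s \<and> t \<le> d \<and> flat f u s t"
      and dis: "disjoint_family_on (\<lambda>(s, t). {s..t}) C" and neg: "negligible (E - (\<Union>(s, t)\<in>C. {s..t}))"
      by (rule Vitali_intervals) blast+
    \<comment> \<open>Only interior points of the flat intervals have small neighbourhoods inside them; the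
      countably many end points are lost.\<close>
    define E' where "E' = E \<inter> (\<Union>(s, t)\<in>C. {s<..<t})"
    have "negligible ((E - (\<Union>(s, t)\<in>C. {s..t})) \<union> (fst ` C \<union> snd ` C))"
      using neg C by (intro negligible_Un) (auto simp: negligible_iff_null_sets intro: countable_imp_null_set_lborel null_sets_completionI)
    then have neg': "negligible (E - E')"
    proof (rule negligible_subset)
      show "E - E' \<subseteq> (E - (\<Union>(s, t)\<in>C. {s..t})) \<union> (fst ` C \<union> snd ` C)"
      proof
        fix x assume x: "x \<in> E - E'"
        show "x \<in> (E - (\<Union>(s, t)\<in>C. {s..t})) \<union> (fst ` C \<union> snd ` C)"
        proof (cases "x \<in> (\<Union>(s, t)\<in>C. {s..t})")
          case True
          then obtain s t where st: "(s, t) \<in> C" "s \<le> x" "x \<le> t" by auto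
          with x have "\<not> (s < x \<and> x < t)" by (auto simp: E'_def)
          with st have "x = s \<or> x = t" by linarith
          with st show ?thesis by (force simp: image_iff)
        qed (use x in auto)
      qed
    qed
    have "around_at_all_scales (\<lambda>s t. (\<exists>(s', t')\<in>C. s' \<le> s \<and> t \<le> t') \<and> steep f v s t) x" if x: "x \<in> E'" for x
      unfolding around_at_all_scales_def
    proof (intro allI impI)
      fix e' :: real assume "e' > 0"
      moreover obtain s' t' where s't': "(s', t') \<in> C" "s' < x" "x < t'"
        using x by (auto simp: E'_def)
      ultimately have "min e' (min (x - s') (t' - x)) > 0" by auto
      with st[of x] x obtain s t where "s \<le> x" "x \<le> t" "s < t" "t - s < min e' (min (x - s') (t' - x))" "steep f v s t"
        unfolding around_at_all_scales_def E'_def by blast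
      then show "\<exists>s t. s \<le> x \<and> x \<le> t \<and> s < t \<and> t - s < e' \<and> (\<exists>(s', t')\<in>C. s' \<le> s \<and> t \<le> t') \<and> steep f v s t"
        using s't' by (intro exI[of _ s] exI[of _ t]) (auto intro!: bexI[of _ "(s', t')"])
    qed
    then obtain C' where C': "countable C'"
      and Cst': "\<And>s t. (s, t) \<in> C' \<Longrightarrow> s < t \<and> (\<exists>(s', t')\<in>C. s' \<le> s \<and> t \<le> t') \<and> steep f v s t"
      and dis': "disjoint_family_on (\<lambda>(s, t). {s..t}) C'" and neg'': "negligible (E' - (\<Union>(s, t)\<in>C'. {s..t}))"
      by (rule Vitali_intervals) blast+
    have cd: "s < t \<and> c \<le> s \<and> t \<le> d" if "(s, t) \<in> C'" for s t
      using Cst'[OF that] Cst by fastforce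
    have "ennreal v * emeasure lebesgue (\<Union>(s, t)\<in>C'. {s..t}) \<le> emeasure lebesgue (\<Union>(s, t)\<in>C'. {f s<..<f t})"
      using Cst' uv by (intro emeasure_image_steep[OF f C' dis' cd]) auto
    also have "\<dots> \<le> emeasure lebesgue (\<Union>(s, t)\<in>C. {f s<..<f t})"
    proof (intro emeasure_mono)
      show "(\<Union>(s, t)\<in>C'. {f s<..<f t}) \<subseteq> (\<Union>(s, t)\<in>C. {f s<..<f t})"
      proof clarify
        fix x s t assume i: "(s, t) \<in> C'" and x: "x \<in> {f s<..<f t}"
        obtain s' t' where i': "(s', t') \<in> C" "s' \<le> s" "t \<le> t'" using Cst'[OF i] by auto
        have "f s' \<le> f s" "f t \<le> f t'" using Cst[OF i'(1)] cd[OF i] i' by (auto intro!: mono_onD[OF f])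
        with x have "x \<in> {f s'<..<f t'}" by auto
        with i' show "x \<in> (\<Union>(s, t)\<in>C. {f s<..<f t})" by blast
      qed
      show "(\<Union>(s, t)\<in>C. {f s<..<f t}) \<in> sets lebesgue"
        using C by (intro sets.countable_UN') auto
    qed
    also have "\<dots> \<le> ennreal u * emeasure lebesgue (\<Union>(s, t)\<in>C. {s..t})"
      using Cst uv by (intro emeasure_image_flat[OF f C dis]) auto
    also have "\<dots> \<le> ennreal u * emeasure lebesgue G"
      using Cst G(1) by (intro mult_left_mono emeasure_mono) fastforce+
    also have "\<dots> \<le> ennreal u * ennreal (measure lebesgue T + e)"
      by (intro mult_left_mono Gm) auto
    also have "\<dots> = ennreal v * ennreal (u / v * (measure lebesgue T + e))"
      using uv e by (simp add: ennreal_mult[symmetric] del: ennreal_plus)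
    finally have B: "emeasure lebesgue (\<Union>(s, t)\<in>C'. {s..t}) \<le> ennreal (u / v * (measure lebesgue T + e))"
      using uv by (subst (asm) ennreal_mult_le_mult_iff) auto
    have "negligible (E - (\<Union>(s, t)\<in>C'. {s..t}))"
      by (rule negligible_subset[OF negligible_Un[OF neg' neg'']]) auto
    moreover have "0 \<le> u / v * (measure lebesgue T + e)" using uv e by auto
    ultimately obtain T' where "T' \<in> lmeasurable" "E \<subseteq> T'" "measure lebesgue T' \<le> u / v * (measure lebesgue T + e)"
      using measurable_superset_of_cover[OF C' _ _ B] by metis
    then show ?thesis
      unfolding \<alpha>_def by (intro cINF_lower2[OF bdd, of T']) (auto simp: \<T>_def)
  qed
  have "\<alpha> \<ge> 0"
    unfolding \<alpha>_def using ne by (intro cINF_greatest) auto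
  have "\<alpha> \<le> u / v * measure lebesgue T" if T: "T \<in> \<T>" for T
  proof (cases "u = 0")
    case True
    with contract[OF T zero_less_one] show ?thesis by simp
  next
    case False
    show ?thesis
    proof (rule field_le_epsilon)
      fix e :: real assume "e > 0"
      then have "e * (v / u) > 0" using uv False by auto
      from contract[OF T this] show "\<alpha> \<le> u / v * measure lebesgue T + e"
        using uv False by (simp add: algebra_simps)
    qed
  qed
  then have "v * \<alpha> \<le> u * measure lebesgue T" if "T \<in> \<T>" for T
    using that uv by (simp add: field_simps)
  have "\<alpha> \<le> 0"
  proof (rule ccontr)
    assume "\<not> \<alpha> \<le> 0"
    then have pos: "\<alpha> > 0" by simp
    show False
    proof (cases "u = 0")
      case True
      with \<open>\<And>T. T \<in> \<T> \<Longrightarrow> v * \<alpha> \<le> u * measure lebesgue T\<close> ne pos uv show False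
        by (auto simp: mult_le_0_iff)
    next
      case False
      then have "v / u * \<alpha> \<le> (INF T\<in>\<T>. measure lebesgue T)"
        using \<open>\<And>T. T \<in> \<T> \<Longrightarrow> v * \<alpha> \<le> u * measure lebesgue T\<close> ne uv
        by (intro cINF_greatest) (auto simp: field_simps)
      with pos uv False show False by (simp add: field_simps flip: \<alpha>_def)
    qed
  qed
  show ?thesis
    unfolding negligible_outer
  proof (intro allI impI)
    fix e :: real assume "e > 0"
    with \<open>\<alpha> \<le> 0\<close> have "(INF T\<in>\<T>. measure lebesgue T) < e" by (simp add: \<alpha>_def)
    then obtain T where "T \<in> \<T>" "measure lebesgue T < e"
      using cINF_less_iff[OF ne bdd] by blast
    then show "\<exists>T. E \<subseteq> T \<and> T \<in> lmeasurable \<and> measure lebesgue T < e"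
      by (auto simp: \<T>_def)
  qed
qed

text \<open>
  The derivative \<open>l\<close> is the infimum of the eventual upper bounds of the difference quotients over
  short intervals around \<open>x\<close>: quotients frequently below some \<open>u < l\<close> could not frequently exceed a rational number between
  \<open>u\<close> and \<open>l\<close>, so a number below \<open>l\<close> would already be an eventual upper bound.
\<close>
lemma differentiable_if_quotients_separate:
  fixes f :: "real \<Rightarrow> real"
  assumes f: "mono_on {c..d} f" and x: "c < x" "x < d" and st: "\<not> around_at_all_scales (steep f v0) x"
    and fs: "\<And>u v. \<lbrakk>u \<in> \<rat>; v \<in> \<rat>; 0 \<le> u; u < v; around_at_all_scales (flat f u) x\<rbrakk> \<Longrightarrow> \<not> around_at_all_scales (steep f v) x"
  shows "f differentiable (at x)"
proof -
  define L where "L = {v. \<not> around_at_all_scales (steep f v) x}"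
  define l where "l = Inf L"
  have mono: "f s \<le> f t" if "s \<le> x" "x \<le> t" "t - s < min (x - c) (d - x)" for s t
    using that x by (intro mono_onD[OF f]) auto
  have "v0 \<in> L" using st by (simp add: L_def)
  have L0: "0 \<le> v" if "v \<in> L" for v
  proof (rule ccontr)
    assume "\<not> 0 \<le> v"
    from that obtain e where e: "e > 0" "\<And>s t. \<lbrakk>s \<le> x; x \<le> t; s < t; t - s < e\<rbrakk> \<Longrightarrow> \<not> steep f v s t"
      unfolding L_def around_at_all_scales_def by blast
    define t where "t = x + min e (min (x - c) (d - x)) / 2"
    have t: "x < t" "t - x < e" "t - x < min (x - c) (d - x)"
      using e(1) x unfolding t_def by (auto simp: min_def)
    have "f x \<le> f t" using mono[of x t] t by simp
    moreover have "v * (t - x) < 0" using \<open>\<not> 0 \<le> v\<close> t by (simp add: mult_neg_pos)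
    ultimately show False using e(2)[of x t] t by simp
  qed
  have bdd: "bdd_below L" using L0 by (rule bdd_belowI)
  have l0: "0 \<le> l" unfolding l_def using \<open>v0 \<in> L\<close> L0 by (intro cInf_greatest) auto
  have no_flat: "\<exists>e>0. \<forall>s t. s \<le> x \<and> x \<le> t \<and> s < t \<and> t - s < e \<longrightarrow> f t - f s \<ge> u * (t - s)" if "u < l" for u
  proof (cases "u < 0")
    case True
    have "f t - f s \<ge> u * (t - s)" if "s \<le> x \<and> x \<le> t \<and> s < t \<and> t - s < min (x - c) (d - x)" for s t
    proof -
      have "f s \<le> f t" using mono that by blast
      moreover have "u * (t - s) < 0" using True that by (simp add: mult_neg_pos)
      ultimately show ?thesis by simp
    qed
    then show ?thesis using x by (intro exI[of _ "min (x - c) (d - x)"]) auto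
  next
    case False
    obtain u' where u': "u' \<in> \<rat>" "u < u'" "u' < l" using Rats_dense_in_real[OF \<open>u < l\<close>] by blast
    obtain v' where v': "v' \<in> \<rat>" "u' < v'" "v' < l" using Rats_dense_in_real[OF \<open>u' < l\<close>] by blast
    have "v' \<notin> L" using v' cInf_lower[OF _ bdd] unfolding l_def by fastforce
    then have "\<not> around_at_all_scales (flat f u') x"
      using fs[of u' v'] u' v' False by (auto simp: L_def)
    then obtain e where e: "e > 0" "\<And>s t. \<lbrakk>s \<le> x; x \<le> t; s < t; t - s < e\<rbrakk> \<Longrightarrow> \<not> flat f u' s t"
      unfolding around_at_all_scales_def by blast
    show ?thesis
    proof (intro exI[of _ e] conjI allI impI)
      fix s t assume a: "s \<le> x \<and> x \<le> t \<and> s < t \<and> t - s < e"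
      then have "u * (t - s) \<le> u' * (t - s)" using u' by (intro mult_right_mono) auto
      also have "\<dots> \<le> f t - f s" using e(2)[of s t] a by (simp only: not_less)
      finally show "f t - f s \<ge> u * (t - s)" .
    qed (fact e)
  qed
  have "((\<lambda>y. (f y - f x) / (y - x)) \<longlongrightarrow> l) (at x)"
  proof (rule LIM_I)
    fix r :: real assume r: "r > 0"
    then have "Inf L < l + r" by (simp add: l_def)
    then obtain v where v: "v \<in> L" "v < l + r"
      using cInf_lessD \<open>v0 \<in> L\<close> by blast
    obtain e1 where e1: "e1 > 0" "\<And>s t. \<lbrakk>s \<le> x; x \<le> t; s < t; t - s < e1\<rbrakk> \<Longrightarrow> \<not> steep f v s t"
      using v(1) unfolding L_def around_at_all_scales_def by blast
    obtain e2 where e2: "e2 > 0" "\<And>s t. \<lbrakk>s \<le> x; x \<le> t; s < t; t - s < e2\<rbrakk> \<Longrightarrow> f t - f s \<ge> (l - r / 2) * (t - s)"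
      using no_flat[of "l - r / 2"] r by auto
    have quot: "\<bar>(f t - f s) / (t - s) - l\<bar> < r" if "s \<le> x" "x \<le> t" "s < t" "t - s < min e1 e2" for s t
    proof -
      have "f t - f s \<le> v * (t - s)" using e1(2)[of s t] that by simp
      then have "(f t - f s) / (t - s) \<le> v" using that by (simp add: divide_le_eq)
      moreover have "l - r / 2 \<le> (f t - f s) / (t - s)" using e2(2)[of s t] that by (simp add: le_divide_eq)
      ultimately show ?thesis using v(2) r by (auto simp: abs_less_iff)
    qed
    show "\<exists>s>0. \<forall>y. y \<noteq> x \<and> norm (y - x) < s \<longrightarrow> norm ((f y - f x) / (y - x) - l) < r"
    proof (intro exI[of _ "min e1 e2"] conjI allI impI)
      fix y assume y: "y \<noteq> x \<and> norm (y - x) < min e1 e2"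
      show "norm ((f y - f x) / (y - x) - l) < r"
      proof (cases "x < y")
        case True
        with quot[of x y] y show ?thesis by simp
      next
        case False
        have "(f y - f x) / (y - x) = (f x - f y) / (x - y)"
          by (metis minus_diff_eq minus_divide_divide)
        with quot[of y x] y False show ?thesis by simp
      qed
    qed (use e1 e2 in auto)
  qed
  then have "(f has_real_derivative l) (at x)"
    by (simp add: has_field_derivative_iff)
  then show ?thesis
    using real_differentiable_def by blast
qed

text \<open>
  Rational bounds \<open>u < v\<close> suffice to detect a gap between lower and upper difference quotients, so
  the points of non-differentiability lie in a countable union of negligible sets.
\<close>
theorem mono_on_differentiable_ae:
  fixes f :: "real \<Rightarrow> real"
  assumes f: "mono_on {c..d} f"
  shows "negligible {x \<in> {c<..<d}. \<not> f differentiable (at x)}"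
proof -
  define E where "E = (\<lambda>u v. {x \<in> {c<..<d}. around_at_all_scales (flat f u) x \<and> around_at_all_scales (steep f v) x})"
  define R :: "(real \<times> real) set" where "R = {(u, v) \<in> \<rat> \<times> \<rat>. 0 \<le> u \<and> u < v}"
  have "countable R"
    by (rule countable_subset[of _ "\<rat> \<times> \<rat>"]) (auto simp: R_def countable_rat)
  then have "negligible (\<Union>i\<in>R. E (fst i) (snd i))"
  proof (intro negligible_countable_Union; clarsimp)
    fix u v assume "(u, v) \<in> R"
    then show "negligible (E u v)"
      by (intro negligible_flat_steep[OF f, of _ u v]) (auto simp: R_def E_def)
  qed
  moreover have "negligible {x \<in> {c<..<d}. \<forall>v. around_at_all_scales (steep f v) x}"
    by (rule negligible_steep[OF f]) auto
  ultimately have "negligible ({x \<in> {c<..<d}. \<forall>v. around_at_all_scales (steep f v) x} \<union> (\<Union>i\<in>R. E (fst i) (snd i)))"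
    by (intro negligible_Un)
  then show ?thesis
  proof (rule negligible_subset)
    show "{x \<in> {c<..<d}. \<not> f differentiable (at x)}
          \<subseteq> {x \<in> {c<..<d}. \<forall>v. around_at_all_scales (steep f v) x} \<union> (\<Union>i\<in>R. E (fst i) (snd i))"
    proof (rule subsetI, rule ccontr)
      fix x assume x: "x \<in> {x \<in> {c<..<d}. \<not> f differentiable (at x)}"
        and "x \<notin> {x \<in> {c<..<d}. \<forall>v. around_at_all_scales (steep f v) x} \<union> (\<Union>i\<in>R. E (fst i) (snd i))"
      then obtain v0 where "\<not> around_at_all_scales (steep f v0) x"
        and "\<And>u v. (u, v) \<in> R \<Longrightarrow> x \<notin> E u v" by fastforce
      then have "f differentiable (at x)"
        using x by (intro differentiable_if_quotients_separate[OF f, of x v0]) (auto simp: R_def E_def)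
      with x show False by simp
    qed
  qed
qed

section \<open>Absolutely continuous functions\<close>

definition intervals_in :: "real \<Rightarrow> real \<Rightarrow> (real \<times> real) set \<Rightarrow> bool" where
  "intervals_in c d D \<longleftrightarrow> finite D \<and> (\<forall>(s, t)\<in>D. c \<le> s \<and> s \<le> t \<and> t \<le> d) \<and>
     disjoint_family_on (\<lambda>(s, t). {s<..<t}) D"

text \<open>
  Jordan decomposition: if \<open>V\<close> is the variation from \<open>c\<close> up to the given point, then \<open>V\<close>,
  \<open>V - Re f\<close> and \<open>V - Im f\<close> are increasing.
\<close>
lemma bounded_variation_differentiable_ae:
  fixes f :: "real \<Rightarrow> complex"
  assumes B: "\<And>D. intervals_in c d D \<Longrightarrow> (\<Sum>(s, t)\<in>D. cmod (f t - f s)) \<le> B"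
  shows "negligible {x \<in> {c<..<d}. \<not> f differentiable (at x)}"
proof -
  define var where "var = (\<lambda>D. \<Sum>(s, t)\<in>D. cmod (f t - f s))"
  define V where "V x = (SUP D\<in>{D. intervals_in c x D}. var D)" for x
  have sub: "intervals_in c y D" if "intervals_in c x D" "x \<le> y" for x y D
    using that unfolding intervals_in_def by fastforce
  have bdd: "bdd_above (var ` {D. intervals_in c x D})" if "x \<le> d" for x
    using B sub[OF _ that] by (auto simp: var_def intro!: bdd_aboveI[of _ B])
  have V: "V x + cmod (f y - f x) \<le> V y" if xy: "c \<le> x" "x \<le> y" "y \<le> d" for x y
  proof -
    have "var D \<le> V y - cmod (f y - f x)" if D: "intervals_in c x D" for D
    proof (cases "x = y")
      case True
      then show ?thesis using D bdd[OF xy(3)] by (auto simp: V_def intro: cSUP_upper)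
    next
      case False
      with xy have "x < y" by simp
      with D have nin: "(x, y) \<notin> D" by (fastforce simp: intervals_in_def)
      have "intervals_in c y (insert (x, y) D)"
        unfolding intervals_in_def
      proof (intro conjI)
        show "finite (insert (x, y) D)" using D by (simp add: intervals_in_def)
        show "\<forall>(s, t)\<in>insert (x, y) D. c \<le> s \<and> s \<le> t \<and> t \<le> y"
          using D xy by (fastforce simp: intervals_in_def)
        have "(\<Union>(s, t)\<in>D. {s<..<t}) \<inter> {x<..<y} = {}"
          using D by (fastforce simp: intervals_in_def)
        then show "disjoint_family_on (\<lambda>(s, t). {s<..<t}) (insert (x, y) D)"
          using D nin unfolding intervals_in_def by (subst disjoint_family_on_insert) auto
      qed
      then have "var (insert (x, y) D) \<le> V y"
        using bdd[OF xy(3)] by (auto simp: V_def intro: cSUP_upper)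
      then show ?thesis using nin D by (simp add: var_def intervals_in_def)
    qed
    moreover have "intervals_in c x {}" by (simp add: intervals_in_def disjoint_family_on_def)
    ultimately have "V x \<le> V y - cmod (f y - f x)"
      unfolding V_def[of x] by (intro cSUP_least) auto
    then show ?thesis by simp
  qed
  have m: "mono_on {c..d} V" "mono_on {c..d} (\<lambda>x. V x - Re (f x))" "mono_on {c..d} (\<lambda>x. V x - Im (f x))"
  proof (rule_tac [!] mono_onI)
    fix x y assume "x \<in> {c..d}" "y \<in> {c..d}" "x \<le> y"
    then have "V x + cmod (f y - f x) \<le> V y" by (intro V) auto
    moreover have "\<bar>Re (f y) - Re (f x)\<bar> \<le> cmod (f y - f x)" "\<bar>Im (f y) - Im (f x)\<bar> \<le> cmod (f y - f x)"
      using abs_Re_le_cmod[of "f y - f x"] abs_Im_le_cmod[of "f y - f x"] by simp_all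
    ultimately show "V x \<le> V y" "V x - Re (f x) \<le> V y - Re (f y)" "V x - Im (f x) \<le> V y - Im (f y)"
      by linarith+
  qed
  have "negligible ({x \<in> {c<..<d}. \<not> V differentiable (at x)} \<union>
      ({x \<in> {c<..<d}. \<not> (\<lambda>x. V x - Re (f x)) differentiable (at x)} \<union>
       {x \<in> {c<..<d}. \<not> (\<lambda>x. V x - Im (f x)) differentiable (at x)}))"
    by (intro negligible_Un mono_on_differentiable_ae m)
  then show ?thesis
  proof (rule negligible_subset)
    have "f differentiable (at x)" if d: "V differentiable (at x)"
      "(\<lambda>x. V x - Re (f x)) differentiable (at x)" "(\<lambda>x. V x - Im (f x)) differentiable (at x)" for x
    proof -
      have "(\<lambda>x. Re (f x)) differentiable (at x)" "(\<lambda>x. Im (f x)) differentiable (at x)"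
        using differentiable_diff[OF d(1,2)] differentiable_diff[OF d(1,3)] by simp_all
      then obtain D D' where D: "((\<lambda>x. Re (f x)) has_derivative D) (at x)" "((\<lambda>x. Im (f x)) has_derivative D') (at x)"
        unfolding differentiable_def by blast
      have "(\<lambda>x. complex_of_real (Re (f x))) differentiable (at x)"
        using has_derivative_of_real[OF D(1)] unfolding differentiable_def by blast
      moreover have "(\<lambda>x. \<i> * complex_of_real (Im (f x))) differentiable (at x)"
        using has_derivative_mult_right[OF has_derivative_of_real[OF D(2)]] unfolding differentiable_def by blast
      ultimately have "(\<lambda>x. complex_of_real (Re (f x)) + \<i> * complex_of_real (Im (f x))) differentiable (at x)"
        by (rule differentiable_add)
      then show ?thesis
        by (simp flip: complex_eq)
    qed
    then show "{x \<in> {c<..<d}. \<not> f differentiable (at x)} \<subseteq> {x \<in> {c<..<d}. \<not> V differentiable (at x)} \<union>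
      ({x \<in> {c<..<d}. \<not> (\<lambda>x. V x - Re (f x)) differentiable (at x)} \<union>
       {x \<in> {c<..<d}. \<not> (\<lambda>x. V x - Im (f x)) differentiable (at x)})"
      by blast
  qed
qed

text \<open>
  On an interval shorter than the \<open>\<delta>\<close> that absolute continuity provides for \<open>\<epsilon> = 1\<close>, every sum of
  increments is below \<open>1\<close>, so the variation is finite there. Countably many such intervals, with
  rational end points, cover \<open>(a,b)\<close>.
\<close>
lemma AC_loc_differentiable_ae:
  assumes f: "f \<in> AC_loc a b"
  shows "AE x in lebesgue. x \<in> einterval a b \<longrightarrow> f differentiable (at x)"
proof -
  define R :: "(real \<times> real) set" where "R = {(c, d) \<in> \<rat> \<times> \<rat>.
     \<exists>B. \<forall>D. intervals_in c d D \<longrightarrow> (\<Sum>(s, t)\<in>D. cmod (f t - f s)) \<le> B}"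
  have "countable R"
    by (rule countable_subset[of _ "\<rat> \<times> \<rat>"]) (auto simp: R_def countable_rat)
  then have neg: "negligible (\<Union>i\<in>R. {x \<in> {fst i<..<snd i}. \<not> f differentiable (at x)})"
  proof (rule negligible_countable_Union[OF countable_image]; clarify)
    fix c d assume "(c, d) \<in> R"
    then obtain B where "\<And>D. intervals_in c d D \<Longrightarrow> (\<Sum>(s, t)\<in>D. cmod (f t - f s)) \<le> B"
      by (auto simp: R_def)
    from bounded_variation_differentiable_ae[OF this]
    show "negligible {x \<in> {fst (c, d)<..<snd (c, d)}. \<not> f differentiable (at x)}" by simp
  qed
  have "\<exists>i\<in>R. x \<in> {fst i<..<snd i}" if x: "x \<in> einterval a b" for x
  proof -
    obtain r where r: "r > 0" "cball x r \<subseteq> einterval a b"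
      using x open_contains_cball open_einterval by blast
    then have "x - r \<in> einterval a b" "x + r \<in> einterval a b" by (auto simp: dist_real_def subset_eq)
    then have "abs_cont_on (x - r) (x + r) f"
      using f r by (auto simp: AC_loc_def einterval_def)
    then obtain \<delta> where \<delta>: "\<delta> > 0" and ac: "\<And>D. \<lbrakk>intervals_in (x - r) (x + r) D; (\<Sum>(s, t)\<in>D. t - s) < \<delta>\<rbrakk>
         \<Longrightarrow> (\<Sum>(s, t)\<in>D. cmod (f t - f s)) < 1"
      unfolding abs_cont_on_def intervals_in_def by (meson zero_less_one)
    define \<rho> where "\<rho> = min r (\<delta> / 2)"
    have \<rho>: "\<rho> > 0" using r \<delta> by (simp add: \<rho>_def)
    obtain c where c: "c \<in> \<rat>" "x - \<rho> < c" "c < x" using Rats_dense_in_real[of "x - \<rho>" x] \<rho> by auto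
    obtain d where d: "d \<in> \<rat>" "x < d" "d < x + \<rho>" using Rats_dense_in_real[of x "x + \<rho>"] \<rho> by auto
    have "(\<Sum>(s, t)\<in>D. cmod (f t - f s)) \<le> 1" if D: "intervals_in c d D" for D
    proof -
      have "ennreal (\<Sum>(s, t)\<in>D. t - s) = (\<Sum>(s, t)\<in>D. ennreal (t - s))"
        using D by (subst sum_ennreal[symmetric]) (auto simp: intervals_in_def split_beta)
      also have "\<dots> = (\<Sum>i\<in>D. emeasure lebesgue ((\<lambda>(s, t). {s<..<t}) i))"
        using D by (intro sum.cong) (auto simp: intervals_in_def)
      also have "\<dots> = emeasure lebesgue (\<Union>(s, t)\<in>D. {s<..<t})"
        using D by (intro sum_emeasure) (auto simp: intervals_in_def)
      also have "\<dots> \<le> emeasure lebesgue {c..d}"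
        using D by (intro emeasure_mono) (fastforce simp: intervals_in_def)+
      also have "\<dots> = ennreal (d - c)" using c d by simp
      finally have "(\<Sum>(s, t)\<in>D. t - s) \<le> d - c" using c d by (subst (asm) ennreal_le_iff) auto
      moreover have "d - c < \<delta>" using c d by (auto simp: \<rho>_def)
      moreover have "intervals_in (x - r) (x + r) D"
        using D c d unfolding intervals_in_def \<rho>_def by fastforce
      ultimately show ?thesis using ac[of D] by simp
    qed
    with c d show ?thesis by (intro bexI[of _ "(c, d)"]) (auto simp: R_def)
  qed
  then have "{x. \<not> (x \<in> einterval a b \<longrightarrow> f differentiable (at x))}
             \<subseteq> (\<Union>i\<in>R. {x \<in> {fst i<..<snd i}. \<not> f differentiable (at x)})"
    by blast
  then show ?thesis
    using neg negligible_subset by (intro AE_I'[of "\<Union>i\<in>R. {x \<in> {fst i<..<snd i}. \<not> f differentiable (at x)}"])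
       (auto simp: negligible_iff_null_sets)
qed

lemma abs_cont_on_iff:
  "abs_cont_on c d f \<longleftrightarrow> (\<forall>e>0. \<exists>\<delta>>0. \<forall>D. intervals_in c d D \<and> (\<Sum>(s, t)\<in>D. t - s) < \<delta> \<longrightarrow>
     (\<Sum>(s, t)\<in>D. cmod (f t - f s)) < e)"
  unfolding abs_cont_on_def intervals_in_def by (simp only: conj_assoc)

lemma AC_locD:
  assumes "f \<in> AC_loc a b" "a < ereal c" "c \<le> d" "ereal d < b" "e > 0"
  obtains \<delta> where "\<delta> > 0" "\<And>D. \<lbrakk>intervals_in c d D; (\<Sum>(s, t)\<in>D. t - s) < \<delta>\<rbrakk> \<Longrightarrow> (\<Sum>(s, t)\<in>D. cmod (f t - f s)) < e"
proof -
  have "abs_cont_on c d f" using assms by (simp add: AC_loc_def)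
  from this[unfolded abs_cont_on_iff, rule_format, OF \<open>e > 0\<close>] show thesis
    using that by blast
qed

lemma AC_locI:
  assumes "\<And>c d e. \<lbrakk>a < ereal c; c \<le> d; ereal d < b; e > 0\<rbrakk> \<Longrightarrow>
    \<exists>\<delta>>0. \<forall>D. intervals_in c d D \<and> (\<Sum>(s, t)\<in>D. t - s) < \<delta> \<longrightarrow> (\<Sum>(s, t)\<in>D. cmod (f t - f s)) < e"
  shows "f \<in> AC_loc a b"
  using assms unfolding AC_loc_def abs_cont_on_iff by blast

lemma AC_loc_cong:
  assumes "\<And>x. x \<in> einterval a b \<Longrightarrow> f x = g x"
  shows "f \<in> AC_loc a b \<longleftrightarrow> g \<in> AC_loc a b"
proof -
  have *: "g \<in> AC_loc a b" if eq: "\<And>x. x \<in> einterval a b \<Longrightarrow> f x = g x" and f: "f \<in> AC_loc a b" for f g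
  proof (rule AC_locI)
    fix c d and e :: real assume cd: "a < ereal c" "c \<le> d" "ereal d < b" and e: "e > 0"
    from AC_locD[OF f cd e] obtain \<delta> where \<delta>: "\<delta> > 0"
      "\<And>D. \<lbrakk>intervals_in c d D; (\<Sum>(s, t)\<in>D. t - s) < \<delta>\<rbrakk> \<Longrightarrow> (\<Sum>(s, t)\<in>D. cmod (f t - f s)) < e" by blast
    have in_ab: "x \<in> einterval a b" if "c \<le> x" "x \<le> d" for x
      using that cd by (auto simp: einterval_def intro: less_le_trans[of a "ereal c"] le_less_trans[of _ "ereal d"])
    have "(\<Sum>(s, t)\<in>D. cmod (g t - g s)) < e" if D: "intervals_in c d D" and len: "(\<Sum>(s, t)\<in>D. t - s) < \<delta>" for D
    proof -
      have "(\<Sum>(s, t)\<in>D. cmod (g t - g s)) = (\<Sum>(s, t)\<in>D. cmod (f t - f s))"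
      proof (intro sum.cong refl, clarify)
        fix s t assume "(s, t) \<in> D"
        with D have "c \<le> s" "s \<le> t" "t \<le> d" by (auto simp: intervals_in_def)
        then show "cmod (g t - g s) = cmod (f t - f s)" by (simp add: eq in_ab)
      qed
      with \<delta>(2)[OF D len] show ?thesis by simp
    qed
    with \<delta>(1) show "\<exists>\<delta>>0. \<forall>D. intervals_in c d D \<and> (\<Sum>(s, t)\<in>D. t - s) < \<delta> \<longrightarrow> (\<Sum>(s, t)\<in>D. cmod (g t - g s)) < e"
      by blast
  qed
  show ?thesis using *[of f g] *[of g f] assms by auto
qed

text \<open>
  Here and below, \<open>\<Lambda>\<close> is a real-linear map applied to the values of two functions. The coefficients
  \<open>p\<close>, \<open>q\<close>, \<open>w\<close> being real, the Sturm--Liouville expression commutes with such maps. The instances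
  in use are complex linear combinations and the conjugation of one function.
\<close>
lemma AC_loc_bounded_linear:
  fixes \<Lambda> :: "complex \<times> complex \<Rightarrow> complex"
  assumes \<Lambda>: "bounded_linear \<Lambda>" and f: "f \<in> AC_loc a b" and g: "g \<in> AC_loc a b"
  shows "(\<lambda>x. \<Lambda> (f x, g x)) \<in> AC_loc a b"
proof (rule AC_locI)
  fix c d and e :: real assume cd: "a < ereal c" "c \<le> d" "ereal d < b" and e: "e > 0"
  obtain K where K: "K > 0" "\<And>z. cmod (\<Lambda> z) \<le> norm z * K"
    using bounded_linear.pos_bounded[OF \<Lambda>] by blast
  define e' where "e' = e / (2 * K)"
  have e': "e' > 0" using e K by (simp add: e'_def)
  from AC_locD[OF f cd e'] obtain \<delta> where \<delta>: "\<delta> > 0"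
    "\<And>D. \<lbrakk>intervals_in c d D; (\<Sum>(s, t)\<in>D. t - s) < \<delta>\<rbrakk> \<Longrightarrow> (\<Sum>(s, t)\<in>D. cmod (f t - f s)) < e'" by blast
  from AC_locD[OF g cd e'] obtain \<delta>' where \<delta>': "\<delta>' > 0"
    "\<And>D. \<lbrakk>intervals_in c d D; (\<Sum>(s, t)\<in>D. t - s) < \<delta>'\<rbrakk> \<Longrightarrow> (\<Sum>(s, t)\<in>D. cmod (g t - g s)) < e'" by blast
  show "\<exists>\<delta>>0. \<forall>D. intervals_in c d D \<and> (\<Sum>(s, t)\<in>D. t - s) < \<delta> \<longrightarrow>
         (\<Sum>(s, t)\<in>D. cmod (\<Lambda> (f t, g t) - \<Lambda> (f s, g s))) < e"
  proof (intro exI[of _ "min \<delta> \<delta>'"] conjI allI impI)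
    fix D assume D: "intervals_in c d D \<and> (\<Sum>(s, t)\<in>D. t - s) < min \<delta> \<delta>'"
    have bound: "cmod (\<Lambda> (f t, g t) - \<Lambda> (f s, g s)) \<le> K * cmod (f t - f s) + K * cmod (g t - g s)" for s t
    proof -
      have "\<Lambda> (f t, g t) - \<Lambda> (f s, g s) = \<Lambda> (f t - f s, g t - g s)"
        using linear_diff[OF bounded_linear.linear[OF \<Lambda>], of "(f t, g t)" "(f s, g s)"] by simp
      also have "cmod \<dots> \<le> norm (f t - f s, g t - g s) * K" by (rule K)
      also have "\<dots> \<le> (cmod (f t - f s) + cmod (g t - g s)) * K"
        using K by (intro mult_right_mono norm_Pair_le) auto
      finally show ?thesis by (simp add: algebra_simps)
    qed
    have "(\<Sum>(s, t)\<in>D. cmod (\<Lambda> (f t, g t) - \<Lambda> (f s, g s)))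
          \<le> (\<Sum>(s, t)\<in>D. K * cmod (f t - f s) + K * cmod (g t - g s))"
      by (intro sum_mono) (auto intro: bound)
    also have "\<dots> = K * (\<Sum>(s, t)\<in>D. cmod (f t - f s)) + K * (\<Sum>(s, t)\<in>D. cmod (g t - g s))"
      by (simp add: split_beta sum.distrib sum_distrib_left)
    also have "\<dots> < K * e' + K * e'"
      using \<delta>(2)[of D] \<delta>'(2)[of D] D K by (intro add_strict_mono mult_strict_left_mono) auto
    also have "\<dots> = e" using K by (simp add: e'_def field_simps)
    finally show "(\<Sum>(s, t)\<in>D. cmod (\<Lambda> (f t, g t) - \<Lambda> (f s, g s))) < e" .
  qed (use \<delta> \<delta>' in auto)
qed

lemma AC_loc_continuous_on:
  assumes f: "f \<in> AC_loc a b"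
  shows "continuous_on (einterval a b) f"
  unfolding continuous_on_iff
proof (intro ballI allI impI)
  fix x and e :: real assume x: "x \<in> einterval a b" and e: "e > 0"
  obtain r where r: "r > 0" "cball x r \<subseteq> einterval a b"
    using x open_contains_cball open_einterval by blast
  then have "x - r \<in> einterval a b" "x + r \<in> einterval a b" by (auto simp: dist_real_def subset_eq)
  then have "a < ereal (x - r)" "x - r \<le> x + r" "ereal (x + r) < b"
    using r by (auto simp: einterval_def)
  from AC_locD[OF f this e] obtain \<delta> where \<delta>: "\<delta> > 0" "\<And>D. \<lbrakk>intervals_in (x - r) (x + r) D;
      (\<Sum>(s, t)\<in>D. t - s) < \<delta>\<rbrakk> \<Longrightarrow> (\<Sum>(s, t)\<in>D. cmod (f t - f s)) < e" by blast
  show "\<exists>d>0. \<forall>x'\<in>einterval a b. dist x' x < d \<longrightarrow> dist (f x') (f x) < e"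
  proof (intro exI[of _ "min \<delta> r"] conjI ballI impI)
    fix y assume "dist y x < min \<delta> r"
    then have "(\<Sum>(s, t)\<in>{(min x y, max x y)}. cmod (f t - f s)) < e"
      by (intro \<delta>(2)) (auto simp: dist_real_def disjoint_family_on_def intervals_in_def)
    then show "dist (f y) (f x) < e"
      by (cases "x \<le> y") (auto simp: dist_norm min_def max_def norm_minus_commute)
  qed (use \<delta> r in auto)
qed

lemma ae_eq_continuous_imp_eq:
  assumes u: "continuous_on (einterval a b) u" and v: "continuous_on (einterval a b) v"
    and ae: "ae_eq a b u v" and x: "x \<in> einterval a b"
  shows "u x = v x"
proof (rule ccontr)
  assume ne: "u x \<noteq> v x"
  define S where "S = einterval a b \<inter> (\<lambda>y. u y - v y) -` (- {0})"
  have "open S"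
    unfolding S_def using continuous_on_diff[OF u v] by (intro continuous_open_preimage) auto
  moreover have "S \<noteq> {}" using ne x by (auto simp: S_def)
  moreover have "negligible S"
    using ae unfolding ae_eq_def negligible_iff_null_sets
    by (subst completion.null_sets_iff_AE) (auto simp: S_def elim: eventually_mono)
  ultimately show False using open_not_negligible by blast
qed

section \<open>Real-linearity of the Sturm--Liouville expression\<close>

lemma ae_eq_refl [simp]: "ae_eq a b f f"
  by (simp add: ae_eq_def)

lemma ae_eq_sym: "ae_eq a b f g \<Longrightarrow> ae_eq a b g f"
  unfolding ae_eq_def by (auto elim: eventually_mono)

lemma ae_eq_compose2:
  assumes "ae_eq a b f f'" "ae_eq a b g g'"
  shows "ae_eq a b (\<lambda>x. H x (f x) (g x)) (\<lambda>x. H x (f' x) (g' x))"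
  using assms unfolding ae_eq_def by eventually_elim auto

lemma ae_eq_trans [trans]:
  "\<lbrakk>ae_eq a b f g; ae_eq a b g h\<rbrakk> \<Longrightarrow> ae_eq a b f h"
  unfolding ae_eq_def by (erule (1) eventually_elim2) auto

lemma ae_eq_cong_left: "ae_eq a b f g \<Longrightarrow> ae_eq a b f h \<longleftrightarrow> ae_eq a b g h"
  using ae_eq_trans ae_eq_sym by blast

lemma has_AC_version_cong: "ae_eq a b f g \<Longrightarrow> has_AC_version a b f \<longleftrightarrow> has_AC_version a b g"
  unfolding has_AC_version_def using ae_eq_cong_left by blast

text \<open>
  Equality and not just equality almost everywhere: functions that agree almost everywhere have the
  same absolutely continuous versions, and the version is chosen from the set of these.
\<close>
lemma AC_deriv_cong: "ae_eq a b f g \<Longrightarrow> AC_deriv a b f = AC_deriv a b g"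
  unfolding AC_deriv_def AC_version_def by (simp add: ae_eq_cong_left[of a b f g])

lemma AC_version:
  assumes "has_AC_version a b f"
  shows "AC_version a b f \<in> AC_loc a b" "ae_eq a b f (AC_version a b f)"
proof -
  have "\<exists>v. v \<in> AC_loc a b \<and> ae_eq a b f v"
    using assms by (auto simp: has_AC_version_def)
  then have "AC_version a b f \<in> AC_loc a b \<and> ae_eq a b f (AC_version a b f)"
    unfolding AC_version_def by (rule someI_ex)
  then show "AC_version a b f \<in> AC_loc a b" "ae_eq a b f (AC_version a b f)" by auto
qed

lemma vector_derivative_bounded_linear_Pair:
  fixes \<Lambda> :: "complex \<times> complex \<Rightarrow> complex"
  assumes \<Lambda>: "bounded_linear \<Lambda>" and x: "x \<in> einterval a b"
    and d: "u differentiable (at x)" "v differentiable (at x)"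
    and z: "\<And>y. y \<in> einterval a b \<Longrightarrow> z y = \<Lambda> (u y, v y)"
  shows "(z has_vector_derivative \<Lambda> (vector_derivative u (at x), vector_derivative v (at x))) (at x)"
proof -
  have "((\<lambda>y. \<Lambda> (u y, v y)) has_vector_derivative \<Lambda> (vector_derivative u (at x), vector_derivative v (at x))) (at x)"
    using d by (intro bounded_linear.has_vector_derivative[OF \<Lambda>] has_vector_derivative_Pair)
      (auto simp: vector_derivative_works[symmetric])
  then show ?thesis
    by (rule has_vector_derivative_transform_within_open[OF _ open_einterval x]) (simp add: z)
qed

text \<open>
  The version of \<open>\<Lambda> (f, g)\<close> is the \<open>\<Lambda>\<close>-image of the versions of \<open>f\<close> and \<open>g\<close> by continuity. The
  derivatives then correspond wherever both versions are differentiable, which is almost everywhere.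
\<close>
lemma AC_deriv_bounded_linear:
  fixes \<Lambda> :: "complex \<times> complex \<Rightarrow> complex"
  assumes \<Lambda>: "bounded_linear \<Lambda>" and f: "has_AC_version a b f" and g: "has_AC_version a b g"
  shows "has_AC_version a b (\<lambda>x. \<Lambda> (f x, g x))"
    and "ae_eq a b (AC_deriv a b (\<lambda>x. \<Lambda> (f x, g x))) (\<lambda>x. \<Lambda> (AC_deriv a b f x, AC_deriv a b g x))"
proof -
  let ?u = "AC_version a b f" and ?v = "AC_version a b g" and ?z = "AC_version a b (\<lambda>x. \<Lambda> (f x, g x))"
  have uv: "(\<lambda>x. \<Lambda> (?u x, ?v x)) \<in> AC_loc a b"
    by (intro AC_loc_bounded_linear \<Lambda> AC_version f g)
  have ae: "ae_eq a b (\<lambda>x. \<Lambda> (f x, g x)) (\<lambda>x. \<Lambda> (?u x, ?v x))"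
    using AC_version(2)[OF f] AC_version(2)[OF g] by (rule ae_eq_compose2)
  show h: "has_AC_version a b (\<lambda>x. \<Lambda> (f x, g x))"
    using uv ae by (auto simp: has_AC_version_def)
  have z: "?z x = \<Lambda> (?u x, ?v x)" if "x \<in> einterval a b" for x
    using AC_version[OF h] uv ae_eq_trans[OF ae_eq_sym[OF AC_version(2)[OF h]] ae] that
    by (intro ae_eq_continuous_imp_eq AC_loc_continuous_on)
  show "ae_eq a b (AC_deriv a b (\<lambda>x. \<Lambda> (f x, g x))) (\<lambda>x. \<Lambda> (AC_deriv a b f x, AC_deriv a b g x))"
    unfolding ae_eq_def AC_deriv_def
    using AC_loc_differentiable_ae[OF AC_version(1)[OF f]] AC_loc_differentiable_ae[OF AC_version(1)[OF g]]
  proof eventually_elim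
    case (elim x)
    show ?case
    proof
      assume x: "x \<in> einterval a b"
      show "vector_derivative ?z (at x) = \<Lambda> (vector_derivative ?u (at x), vector_derivative ?v (at x))"
        using elim x by (intro vector_derivative_at vector_derivative_bounded_linear_Pair[OF \<Lambda> x _ _ z]) auto
    qed
  qed
qed

lemma sl_expr_cong:
  assumes "ae_eq a b f g"
  shows "ae_eq a b (sl_expr a b p q w f) (sl_expr a b p q w g)"
  unfolding sl_expr_def AC_deriv_cong[OF assms]
  by (rule ae_eq_compose2[OF assms ae_eq_refl])

lemma sl_expr_bounded_linear:
  fixes \<Lambda> :: "complex \<times> complex \<Rightarrow> complex"
  assumes \<Lambda>: "bounded_linear \<Lambda>" and f: "has_AC_version a b f" and g: "has_AC_version a b g"
    and pf: "has_AC_version a b (\<lambda>t. of_real (p t) * AC_deriv a b f t)"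
    and pg: "has_AC_version a b (\<lambda>t. of_real (p t) * AC_deriv a b g t)"
  shows "has_AC_version a b (\<lambda>t. of_real (p t) * AC_deriv a b (\<lambda>x. \<Lambda> (f x, g x)) t)"
    and "ae_eq a b (sl_expr a b p q w (\<lambda>x. \<Lambda> (f x, g x)))
           (\<lambda>x. \<Lambda> (sl_expr a b p q w f x, sl_expr a b p q w g x))"
proof -
  have scale: "of_real r * \<Lambda> (y, z) = \<Lambda> (of_real r * y, of_real r * z)" for r y z
    using linear_scale[OF bounded_linear.linear[OF \<Lambda>], of r "(y, z)"] by (simp add: scaleR_conv_of_real)
  have add: "\<Lambda> (y, z) + \<Lambda> (y', z') = \<Lambda> (y + y', z + z')" for y z y' z'
    using linear_add[OF bounded_linear.linear[OF \<Lambda>], of "(y, z)" "(y', z')"] by simp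
  have "ae_eq a b (\<lambda>t. of_real (p t) * AC_deriv a b (\<lambda>x. \<Lambda> (f x, g x)) t)
          (\<lambda>t. of_real (p t) * \<Lambda> (AC_deriv a b f t, AC_deriv a b g t))"
    by (rule ae_eq_compose2[OF AC_deriv_bounded_linear(2)[OF \<Lambda> f g] ae_eq_refl])
  then have ae: "ae_eq a b (\<lambda>t. of_real (p t) * AC_deriv a b (\<lambda>x. \<Lambda> (f x, g x)) t)
          (\<lambda>t. \<Lambda> (of_real (p t) * AC_deriv a b f t, of_real (p t) * AC_deriv a b g t))"
    by (simp add: scale)
  show "has_AC_version a b (\<lambda>t. of_real (p t) * AC_deriv a b (\<lambda>x. \<Lambda> (f x, g x)) t)"
    using AC_deriv_bounded_linear(1)[OF \<Lambda> pf pg] by (simp add: has_AC_version_cong[OF ae])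
  have "ae_eq a b (sl_expr a b p q w (\<lambda>x. \<Lambda> (f x, g x)))
     (\<lambda>x. - (1 / of_real (w x)) * (\<Lambda> (AC_deriv a b (\<lambda>t. of_real (p t) * AC_deriv a b f t) x,
         AC_deriv a b (\<lambda>t. of_real (p t) * AC_deriv a b g t) x) + of_real (q x) * \<Lambda> (f x, g x)))"
    unfolding sl_expr_def AC_deriv_cong[OF ae]
    by (rule ae_eq_compose2[OF AC_deriv_bounded_linear(2)[OF \<Lambda> pf pg] ae_eq_refl])
  also have "(\<lambda>x. - (1 / of_real (w x)) * (\<Lambda> (AC_deriv a b (\<lambda>t. of_real (p t) * AC_deriv a b f t) x,
         AC_deriv a b (\<lambda>t. of_real (p t) * AC_deriv a b g t) x) + of_real (q x) * \<Lambda> (f x, g x)))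
      = (\<lambda>x. \<Lambda> (sl_expr a b p q w f x, sl_expr a b p q w g x))"
  proof
    fix x
    have "- (1 / of_real (w x)) = complex_of_real (- (1 / w x))" by simp
    then show "- (1 / of_real (w x)) * (\<Lambda> (AC_deriv a b (\<lambda>t. of_real (p t) * AC_deriv a b f t) x,
         AC_deriv a b (\<lambda>t. of_real (p t) * AC_deriv a b g t) x) + of_real (q x) * \<Lambda> (f x, g x))
       = \<Lambda> (sl_expr a b p q w f x, sl_expr a b p q w g x)"
      unfolding sl_expr_def by (simp only: scale add)
  qed
  finally show "ae_eq a b (sl_expr a b p q w (\<lambda>x. \<Lambda> (f x, g x)))
           (\<lambda>x. \<Lambda> (sl_expr a b p q w f x, sl_expr a b p q w g x))" .
qed

lemma sl_pow_Suc: "sl_pow a b p q w (Suc n) f = sl_expr a b p q w (sl_pow a b p q w n f)"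
  by (simp add: sl_pow_def)

lemma sl_pow_bounded_linear:
  fixes \<Lambda> :: "complex \<times> complex \<Rightarrow> complex"
  assumes \<Lambda>: "bounded_linear \<Lambda>" and f: "sl_pow_defined a b p q w n f" and g: "sl_pow_defined a b p q w n g"
  shows "ae_eq a b (sl_pow a b p q w n (\<lambda>x. \<Lambda> (f x, g x)))
           (\<lambda>x. \<Lambda> (sl_pow a b p q w n f x, sl_pow a b p q w n g x))"
    and "sl_pow_defined a b p q w n (\<lambda>x. \<Lambda> (f x, g x))"
proof -
  let ?h = "\<lambda>x. \<Lambda> (f x, g x)"
  have ae: "ae_eq a b (sl_pow a b p q w j ?h) (\<lambda>x. \<Lambda> (sl_pow a b p q w j f x, sl_pow a b p q w j g x))"
    if "j \<le> n" for j
    using that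
  proof (induction j)
    case (Suc j)
    then have "j < n" by simp
    have "ae_eq a b (sl_pow a b p q w (Suc j) ?h)
       (sl_expr a b p q w (\<lambda>x. \<Lambda> (sl_pow a b p q w j f x, sl_pow a b p q w j g x)))"
      using Suc by (simp add: sl_pow_Suc sl_expr_cong)
    also have "ae_eq a b \<dots> (\<lambda>x. \<Lambda> (sl_pow a b p q w (Suc j) f x, sl_pow a b p q w (Suc j) g x))"
      unfolding sl_pow_Suc using f g \<open>j < n\<close>
      by (intro sl_expr_bounded_linear(2) \<Lambda>) (auto simp: sl_pow_defined_def)
    finally show ?case .
  qed (simp add: sl_pow_def)
  then show "ae_eq a b (sl_pow a b p q w n ?h) (\<lambda>x. \<Lambda> (sl_pow a b p q w n f x, sl_pow a b p q w n g x))"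
    by simp
  show "sl_pow_defined a b p q w n ?h"
    unfolding sl_pow_defined_def
  proof (intro allI impI conjI)
    fix j assume j: "j < n"
    note aej = ae[OF less_imp_le[OF j]]
    show "has_AC_version a b (sl_pow a b p q w j ?h)"
      unfolding has_AC_version_cong[OF aej] using f g j
      by (intro AC_deriv_bounded_linear(1) \<Lambda>) (auto simp: sl_pow_defined_def)
    show "has_AC_version a b (\<lambda>t. of_real (p t) * AC_deriv a b (sl_pow a b p q w j ?h) t)"
      unfolding AC_deriv_cong[OF aej] using f g j
      by (intro sl_expr_bounded_linear(1) \<Lambda>) (auto simp: sl_pow_defined_def)
  qed
qed

lemma AC_derivs_bounded_linear:
  fixes \<Lambda> :: "complex \<times> complex \<Rightarrow> complex"
  assumes \<Lambda>: "bounded_linear \<Lambda>" and f: "AC_derivs a b r f" and g: "AC_derivs a b r g"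
  shows "AC_derivs a b r (\<lambda>x. \<Lambda> (f x, g x))"
proof -
  let ?h = "\<lambda>x. \<Lambda> (f x, g x)"
  have nderiv_Suc: "nderiv (Suc k) h x = vector_derivative (nderiv k h) (at x)" for k h x
    by (simp add: nderiv_def)
  have diff: "nderiv k f differentiable (at x)" "nderiv k g differentiable (at x)"
    if "Suc k < r" "x \<in> einterval a b" for k x
    using that f g by (auto simp: AC_derivs_def)
  have eq: "nderiv k ?h x = \<Lambda> (nderiv k f x, nderiv k g x)" if "k < r" "x \<in> einterval a b" for k x
    using that
  proof (induction k arbitrary: x)
    case (Suc k)
    then show ?case
      unfolding nderiv_Suc by (intro vector_derivative_at vector_derivative_bounded_linear_Pair[OF \<Lambda>, of x a b] diff) auto
  qed (simp add: nderiv_def)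
  show ?thesis
    unfolding AC_derivs_def
  proof (intro conjI allI impI ballI)
    fix k x assume "Suc k < r" "x \<in> einterval a b"
    then have "(nderiv k ?h has_vector_derivative
        \<Lambda> (vector_derivative (nderiv k f) (at x), vector_derivative (nderiv k g) (at x))) (at x)"
      by (intro vector_derivative_bounded_linear_Pair[OF \<Lambda>, of x a b] diff eq) auto
    then show "nderiv k ?h differentiable (at x)" by (rule differentiableI_vector)
  next
    fix k assume k: "k < r"
    then have "(\<lambda>x. \<Lambda> (nderiv k f x, nderiv k g x)) \<in> AC_loc a b"
      using f g by (intro AC_loc_bounded_linear \<Lambda>) (auto simp: AC_derivs_def)
    then show "nderiv k ?h \<in> AC_loc a b"
      using eq[OF k] by (subst AC_loc_cong[of a b _ "\<lambda>x. \<Lambda> (nderiv k f x, nderiv k g x)"]) auto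
  qed
qed

lemma sl_dom_bounded_linear:
  fixes \<Lambda> :: "complex \<times> complex \<Rightarrow> complex"
  assumes \<Lambda>: "bounded_linear \<Lambda>" and "f \<in> sl_dom a b p q w n" "g \<in> sl_dom a b p q w n"
  shows "(\<lambda>x. \<Lambda> (f x, g x)) \<in> sl_dom a b p q w n"
  using assms AC_derivs_bounded_linear[OF \<Lambda>] sl_pow_bounded_linear(2)[OF \<Lambda>]
    linear_0[OF bounded_linear.linear[OF \<Lambda>]] by (auto simp: sl_dom_def zero_prod_def)

text \<open>
  Passing from classes in the Hilbert space back to functions: members of the domain are continuous
  on \<open>(a,b)\<close> and vanish outside.
\<close>
lemma sl_dom_eqI:
  assumes n: "n \<ge> 1" and f: "f \<in> sl_dom a b p q w n" and g: "g \<in> sl_dom a b p q w n" and ae: "ae_eq a b f g"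
  shows "f = g"
proof
  fix x
  have "nderiv 0 f \<in> AC_loc a b" "nderiv 0 g \<in> AC_loc a b"
    using f g n by (auto simp: sl_dom_def AC_derivs_def)
  then have "continuous_on (einterval a b) f" "continuous_on (einterval a b) g"
    by (auto simp: nderiv_def intro: AC_loc_continuous_on)
  from ae_eq_continuous_imp_eq[OF this ae, of x] show "f x = g x"
    using f g by (cases "x \<in> einterval a b") (auto simp: sl_dom_def)
qed

section \<open>Square integrable functions and orthogonal series\<close>

definition sq_integrable :: "'a measure \<Rightarrow> ('a \<Rightarrow> complex) set" where
  "sq_integrable M = {f \<in> borel_measurable M. integrable M (\<lambda>x. (cmod (f x))\<^sup>2)}"

definition sq_inner :: "'a measure \<Rightarrow> ('a \<Rightarrow> complex) \<Rightarrow> ('a \<Rightarrow> complex) \<Rightarrow> complex" where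
  "sq_inner M f g = (LINT x|M. f x * cnj (g x))"

lemma sq_integrable_measurable [measurable_dest]: "f \<in> sq_integrable M \<Longrightarrow> f \<in> borel_measurable M"
  by (simp add: sq_integrable_def)

lemma borel_measurable_cnj [measurable]: "f \<in> borel_measurable M \<Longrightarrow> (\<lambda>x. cnj (f x)) \<in> borel_measurable M"
  by (erule measurable_compose[where g = cnj]) (intro borel_measurable_continuous_onI continuous_intros)

lemma sq_integrable_mult:
  assumes f: "f \<in> sq_integrable M" and g: "g \<in> sq_integrable M"
  shows "integrable M (\<lambda>x. f x * cnj (g x))"
proof (rule Bochner_Integration.integrable_bound)
  show "integrable M (\<lambda>x. (cmod (f x))\<^sup>2 + (cmod (g x))\<^sup>2)"
    using f g by (auto simp: sq_integrable_def)
  show "(\<lambda>x. f x * cnj (g x)) \<in> borel_measurable M"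
    using f g by measurable
  have "cmod (f x * cnj (g x)) \<le> norm ((cmod (f x))\<^sup>2 + (cmod (g x))\<^sup>2)" for x
  proof -
    have "2 * cmod (f x) * cmod (g x) \<le> (cmod (f x))\<^sup>2 + (cmod (g x))\<^sup>2"
      by (rule sum_squares_bound)
    moreover have "0 \<le> cmod (f x) * cmod (g x)" by simp
    ultimately have "cmod (f x) * cmod (g x) \<le> (cmod (f x))\<^sup>2 + (cmod (g x))\<^sup>2" by linarith
    then show ?thesis by (simp add: norm_mult)
  qed
  then show "AE x in M. cmod (f x * cnj (g x)) \<le> norm ((cmod (f x))\<^sup>2 + (cmod (g x))\<^sup>2)" by simp
qed

lemma sq_integrable_bounded_linear:
  fixes \<Lambda> :: "complex \<times> complex \<Rightarrow> complex"
  assumes \<Lambda>: "bounded_linear \<Lambda>" and f: "f \<in> sq_integrable M" and g: "g \<in> sq_integrable M"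
  shows "(\<lambda>x. \<Lambda> (f x, g x)) \<in> sq_integrable M"
proof -
  obtain K where K: "\<And>z. cmod (\<Lambda> z) \<le> norm z * K"
    using bounded_linear.pos_bounded[OF \<Lambda>] by blast
  have [measurable]: "f \<in> borel_measurable M" "g \<in> borel_measurable M"
    using f g by (auto simp: sq_integrable_def)
  have "continuous_on UNIV \<Lambda>" by (rule linear_continuous_on[OF \<Lambda>])
  then have \<Lambda>m [measurable]: "\<Lambda> \<in> borel_measurable borel"
    by (rule borel_measurable_continuous_onI)
  have m: "(\<lambda>x. \<Lambda> (f x, g x)) \<in> borel_measurable M"
    by (rule measurable_compose[OF _ \<Lambda>m]) measurable
  have "integrable M (\<lambda>x. (cmod (\<Lambda> (f x, g x)))\<^sup>2)"
  proof (rule Bochner_Integration.integrable_bound)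
    show "integrable M (\<lambda>x. K\<^sup>2 * ((cmod (f x))\<^sup>2 + (cmod (g x))\<^sup>2))"
      using f g by (auto simp: sq_integrable_def)
    have "(cmod (\<Lambda> (f x, g x)))\<^sup>2 \<le> K\<^sup>2 * ((cmod (f x))\<^sup>2 + (cmod (g x))\<^sup>2)" for x
    proof -
      have "(cmod (\<Lambda> (f x, g x)))\<^sup>2 \<le> (norm (f x, g x) * K)\<^sup>2"
        by (intro power_mono K) auto
      also have "\<dots> = K\<^sup>2 * ((cmod (f x))\<^sup>2 + (cmod (g x))\<^sup>2)"
        by (simp add: norm_Pair power_mult_distrib)
      finally show ?thesis .
    qed
    then show "AE x in M. norm ((cmod (\<Lambda> (f x, g x)))\<^sup>2) \<le> norm (K\<^sup>2 * ((cmod (f x))\<^sup>2 + (cmod (g x))\<^sup>2))"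
      by simp
  qed (use m in measurable)
  with m show ?thesis by (simp add: sq_integrable_def)
qed

lemma sq_integrable_lincomb:
  assumes "f \<in> sq_integrable M" "g \<in> sq_integrable M"
  shows "(\<lambda>x. c * f x + d * g x) \<in> sq_integrable M"
proof -
  have "bounded_linear (\<lambda>z. c * fst z + d * snd z)"
    by (intro bounded_linear_intros)
  from sq_integrable_bounded_linear[OF this assms] show ?thesis by simp
qed

lemma sq_integrable_add: "\<lbrakk>f \<in> sq_integrable M; g \<in> sq_integrable M\<rbrakk> \<Longrightarrow> (\<lambda>x. f x + g x) \<in> sq_integrable M"
  using sq_integrable_lincomb[of f M g 1 1] by simp

lemma sq_integrable_diff: "\<lbrakk>f \<in> sq_integrable M; g \<in> sq_integrable M\<rbrakk> \<Longrightarrow> (\<lambda>x. f x - g x) \<in> sq_integrable M"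
  using sq_integrable_lincomb[of f M g 1 "-1"] by simp

lemma sq_integrable_cmult: "f \<in> sq_integrable M \<Longrightarrow> (\<lambda>x. c * f x) \<in> sq_integrable M"
  using sq_integrable_lincomb[of f M f c 0] by simp

lemma sq_integrable_sum:
  "(\<And>i. i \<in> I \<Longrightarrow> f i \<in> sq_integrable M) \<Longrightarrow> (\<lambda>x. \<Sum>i\<in>I. f i x) \<in> sq_integrable M"
  by (induction I rule: infinite_finite_induct) (auto simp: sq_integrable_add, auto simp: sq_integrable_def)

lemma sq_inner_lincomb_left:
  assumes "f \<in> sq_integrable M" "g \<in> sq_integrable M" "h \<in> sq_integrable M"
  shows "sq_inner M (\<lambda>x. c * f x + d * g x) h = c * sq_inner M f h + d * sq_inner M g h"
proof -
  have "sq_inner M (\<lambda>x. c * f x + d * g x) h = (LINT x|M. c * (f x * cnj (h x)) + d * (g x * cnj (h x)))"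
    unfolding sq_inner_def by (simp add: algebra_simps)
  also have "\<dots> = c * sq_inner M f h + d * sq_inner M g h"
    unfolding sq_inner_def using assms by (simp add: sq_integrable_mult)
  finally show ?thesis .
qed

lemma sq_inner_commute: "sq_inner M g f = cnj (sq_inner M f g)"
  unfolding sq_inner_def Bochner_Integration.integral_cnj[symmetric] by (simp add: mult.commute)

lemma sq_inner_cmult_left:
  assumes "f \<in> sq_integrable M" "h \<in> sq_integrable M"
  shows "sq_inner M (\<lambda>x. c * f x) h = c * sq_inner M f h"
  using sq_inner_lincomb_left[OF assms(1,1,2), of c 0] by simp

lemma sq_inner_diff_left:
  assumes "f \<in> sq_integrable M" "g \<in> sq_integrable M" "h \<in> sq_integrable M"
  shows "sq_inner M (\<lambda>x. f x - g x) h = sq_inner M f h - sq_inner M g h"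
  using sq_inner_lincomb_left[OF assms, of 1 "-1"] by simp

lemma sq_inner_sum_left:
  assumes "\<And>i. i \<in> I \<Longrightarrow> f i \<in> sq_integrable M" "h \<in> sq_integrable M"
  shows "sq_inner M (\<lambda>x. \<Sum>i\<in>I. c i * f i x) h = (\<Sum>i\<in>I. c i * sq_inner M (f i) h)"
proof -
  have "sq_inner M (\<lambda>x. \<Sum>i\<in>I. c i * f i x) h = (LINT x|M. (\<Sum>i\<in>I. c i * (f i x * cnj (h x))))"
    unfolding sq_inner_def by (simp add: sum_distrib_right mult.assoc)
  also have "\<dots> = (\<Sum>i\<in>I. c i * sq_inner M (f i) h)"
    unfolding sq_inner_def using assms by (simp add: sq_integrable_mult)
  finally show ?thesis .
qed

lemma sq_inner_lincomb_right:
  assumes "f \<in> sq_integrable M" "g \<in> sq_integrable M" "h \<in> sq_integrable M"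
  shows "sq_inner M h (\<lambda>x. c * f x + d * g x) = cnj c * sq_inner M h f + cnj d * sq_inner M h g"
  using sq_inner_lincomb_left[OF assms, of c d] sq_inner_commute[of M h]
    sq_inner_commute[of M h "\<lambda>x. c * f x + d * g x"] by simp

lemma sq_inner_self: "sq_inner M f f = of_real (LINT x|M. (cmod (f x))\<^sup>2)"
proof -
  have "f x * cnj (f x) = of_real ((cmod (f x))\<^sup>2)" for x
    by (metis complex_norm_square)
  then show ?thesis unfolding sq_inner_def by (simp only: integral_complex_of_real)
qed

lemma sq_inner_cong:
  assumes "AE x in M. f x = f' x" "AE x in M. g x = g' x"
    "f \<in> borel_measurable M" "f' \<in> borel_measurable M" "g \<in> borel_measurable M" "g' \<in> borel_measurable M"
  shows "sq_inner M f g = sq_inner M f' g'"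
  unfolding sq_inner_def using assms by (intro integral_cong_AE) (measurable, auto)

lemma sq_inner_self_eq_0:
  assumes f: "f \<in> sq_integrable M"
  shows "sq_inner M f f = 0 \<longleftrightarrow> (AE x in M. f x = 0)"
  using f by (simp add: sq_inner_self sq_integrable_def integral_nonneg_eq_0_iff_AE)

text \<open>
  A substitute for the Cauchy-Schwarz inequality, with a free parameter in place of the square roots.
\<close>
lemma norm_sq_inner_le:
  assumes f: "f \<in> sq_integrable M" and g: "g \<in> sq_integrable M" and t: "t > 0"
  shows "cmod (sq_inner M f g) \<le> t * (LINT x|M. (cmod (f x))\<^sup>2) + (LINT x|M. (cmod (g x))\<^sup>2) / t"
proof -
  have "cmod (sq_inner M f g) \<le> (LINT x|M. cmod (f x * cnj (g x)))"
    unfolding sq_inner_def by (rule integral_norm_bound)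
  also have "\<dots> \<le> (LINT x|M. t * (cmod (f x))\<^sup>2 + (cmod (g x))\<^sup>2 / t)"
  proof (rule integral_mono)
    fix x
    have "2 * (sqrt t * cmod (f x)) * (cmod (g x) / sqrt t) \<le> (sqrt t * cmod (f x))\<^sup>2 + (cmod (g x) / sqrt t)\<^sup>2"
      by (rule sum_squares_bound)
    then have "2 * (cmod (f x) * cmod (g x)) \<le> t * (cmod (f x))\<^sup>2 + (cmod (g x))\<^sup>2 / t"
      using t by (simp add: power_mult_distrib power_divide)
    moreover have "0 \<le> cmod (f x) * cmod (g x)" by simp
    ultimately have "cmod (f x) * cmod (g x) \<le> t * (cmod (f x))\<^sup>2 + (cmod (g x))\<^sup>2 / t"
      by linarith
    then show "cmod (f x * cnj (g x)) \<le> t * (cmod (f x))\<^sup>2 + (cmod (g x))\<^sup>2 / t"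
      by (simp add: norm_mult)
  qed (use f g sq_integrable_mult[OF f g] in \<open>auto simp: sq_integrable_def\<close>)
  also have "\<dots> = t * (LINT x|M. (cmod (f x))\<^sup>2) + (LINT x|M. (cmod (g x))\<^sup>2) / t"
    using f g by (simp add: sq_integrable_def)
  finally show ?thesis .
qed

lemma sq_inner_tendsto:
  assumes S: "\<And>n. S n \<in> sq_integrable M" and h: "h \<in> sq_integrable M" and g: "g \<in> sq_integrable M"
    and lim: "(\<lambda>n. LINT x|M. (cmod (S n x - h x))\<^sup>2) \<longlonglongrightarrow> 0"
  shows "(\<lambda>n. sq_inner M (S n) g) \<longlonglongrightarrow> sq_inner M h g"
proof (rule LIMSEQ_I)
  fix r :: real assume r: "r > 0"
  define G where "G = (LINT x|M. (cmod (g x))\<^sup>2)"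
  have "G \<ge> 0" by (simp add: G_def)
  \<comment> \<open>With this parameter the contribution of \<open>g\<close> is below \<open>r / 2\<close>.\<close>
  define t where "t = 2 * (G + 1) / r"
  have t: "t > 0" using r \<open>G \<ge> 0\<close> by (simp add: t_def)
  have Gt: "G / t < r / 2"
    using r \<open>G \<ge> 0\<close> by (simp add: t_def field_simps)
  have "r / (2 * t) > 0" using r t by simp
  from LIMSEQ_D[OF lim this] obtain N where N: "\<And>n. n \<ge> N \<Longrightarrow> (LINT x|M. (cmod (S n x - h x))\<^sup>2) < r / (2 * t)"
    by fastforce
  show "\<exists>N. \<forall>n\<ge>N. norm (sq_inner M (S n) g - sq_inner M h g) < r"
  proof (intro exI[of _ N] allI impI)
    fix n assume "n \<ge> N"
    have "norm (sq_inner M (S n) g - sq_inner M h g) = cmod (sq_inner M (\<lambda>x. S n x - h x) g)"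
      by (simp add: sq_inner_diff_left S h g)
    also have "\<dots> \<le> t * (LINT x|M. (cmod (S n x - h x))\<^sup>2) + G / t"
      unfolding G_def by (intro norm_sq_inner_le t g sq_integrable_diff S h)
    also have "\<dots> < t * (r / (2 * t)) + r / 2"
      using N[OF \<open>n \<ge> N\<close>] t Gt by (intro add_strict_mono mult_strict_left_mono)
    also have "\<dots> = r" using t by simp
    finally show "norm (sq_inner M (S n) g - sq_inner M h g) < r" .
  qed
qed

lemma nn_integral_sq:
  assumes "f \<in> sq_integrable M"
  shows "(\<integral>\<^sup>+x. ennreal ((cmod (f x))\<^sup>2) \<partial>M) = ennreal (LINT x|M. (cmod (f x))\<^sup>2)"
  using assms by (intro nn_integral_eq_integral) (auto simp: sq_integrable_def)

text \<open>
  Pass to a subsequence whose increments \<open>d j\<close> have squared norm below \<open>4\<close> to the power \<open>- j\<close>. Then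
  the sum of the \<open>2 ^ j * (cmod (d j x))\<^sup>2\<close> has a finite integral, so it is finite for almost every
  \<open>x\<close>, and since \<open>cmod (d j x) \<le> (1 / 2) ^ j + 2 ^ j * (cmod (d j x))\<^sup>2\<close> the increments are summable
  there. Fatou's lemma bounds the distance of every \<open>S n\<close> to the pointwise limit.
\<close>
theorem Riesz_Fischer:
  assumes S: "\<And>n. S n \<in> sq_integrable M"
    and Cauchy: "\<And>e. e > 0 \<Longrightarrow> \<exists>N. \<forall>m\<ge>N. \<forall>n\<ge>N. (LINT x|M. (cmod (S m x - S n x))\<^sup>2) < e"
  obtains h where "h \<in> sq_integrable M" "(\<lambda>n. LINT x|M. (cmod (S n x - h x))\<^sup>2) \<longlonglongrightarrow> 0"
proof -
  have [measurable]: "S n \<in> borel_measurable M" for n using S by (auto simp: sq_integrable_def)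
  have "\<forall>j. \<exists>N. \<forall>m\<ge>N. \<forall>n\<ge>N. (LINT x|M. (cmod (S m x - S n x))\<^sup>2) < (1 / 4) ^ j"
    using Cauchy by simp
  then obtain N where N: "\<And>j m n. \<lbrakk>m \<ge> N j; n \<ge> N j\<rbrakk> \<Longrightarrow> (LINT x|M. (cmod (S m x - S n x))\<^sup>2) < (1 / 4) ^ j"
    by metis
  \<comment> \<open>Beyond \<open>N i\<close> for all \<open>i \<le> j\<close>, and unbounded.\<close>
  define r where "r j = (\<Sum>i\<le>j. N i) + j" for j
  have r_ge: "r i \<ge> N j" if "j \<le> i" for i j
  proof -
    have "N j \<le> (\<Sum>i\<le>i. N i)" using that by (intro member_le_sum) auto
    then show ?thesis by (simp add: r_def)
  qed
  define d where "d j x = S (r (Suc j)) x - S (r j) x" for j x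
  have d_sq: "d j \<in> sq_integrable M" for j unfolding d_def by (intro sq_integrable_diff S)
  then have [measurable]: "d j \<in> borel_measurable M" for j by (simp add: sq_integrable_def)
  have "(\<integral>\<^sup>+x. (\<Sum>j. ennreal (2 ^ j * (cmod (d j x))\<^sup>2)) \<partial>M) = (\<Sum>j. \<integral>\<^sup>+x. ennreal (2 ^ j * (cmod (d j x))\<^sup>2) \<partial>M)"
    by (intro nn_integral_suminf) measurable
  also have "\<dots> \<le> (\<Sum>j. ennreal ((1 / 2) ^ j))"
  proof (intro suminf_le summableI)
    fix j
    have "(\<integral>\<^sup>+x. ennreal (2 ^ j * (cmod (d j x))\<^sup>2) \<partial>M) = (\<integral>\<^sup>+x. ennreal (2 ^ j) * ennreal ((cmod (d j x))\<^sup>2) \<partial>M)"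
      by (intro nn_integral_cong ennreal_mult) auto
    also have "\<dots> = ennreal (2 ^ j) * (\<integral>\<^sup>+x. ennreal ((cmod (d j x))\<^sup>2) \<partial>M)"
      by (intro nn_integral_cmult) measurable
    also have "\<dots> = ennreal (2 ^ j * (LINT x|M. (cmod (d j x))\<^sup>2))"
      unfolding nn_integral_sq[OF d_sq] by (rule ennreal_mult[symmetric]) auto
    also have "\<dots> \<le> ennreal (2 ^ j * (1 / 4) ^ j)"
      unfolding d_def using r_ge by (intro ennreal_leI mult_left_mono less_imp_le[OF N]) auto
    also have "2 ^ j * (1 / 4) ^ j = ((1 / 2) ^ j :: real)"
      by (simp flip: power_mult_distrib)
    finally show "(\<integral>\<^sup>+x. ennreal (2 ^ j * (cmod (d j x))\<^sup>2) \<partial>M) \<le> ennreal ((1 / 2) ^ j)" .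
  qed
  also have "\<dots> = ennreal (\<Sum>j. (1 / 2) ^ j)"
    by (intro suminf_ennreal2) (auto intro: summable_geometric)
  finally have "(\<integral>\<^sup>+x. (\<Sum>j. ennreal (2 ^ j * (cmod (d j x))\<^sup>2)) \<partial>M) < \<infinity>"
    by (simp add: le_less_trans)
  then have "AE x in M. (\<Sum>j. ennreal (2 ^ j * (cmod (d j x))\<^sup>2)) \<noteq> \<infinity>"
    by (intro nn_integral_PInf_AE) auto
  then have conv: "AE x in M. convergent (\<lambda>j. S (r j) x)"
  proof eventually_elim
    case (elim x)
    then have "summable (\<lambda>j. 2 ^ j * (cmod (d j x))\<^sup>2)"
      by (intro summable_suminf_not_top) auto
    moreover have "summable (\<lambda>j. (1 / 2 :: real) ^ j)" by (intro summable_geometric) auto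
    ultimately have sm: "summable (\<lambda>j. (1 / 2) ^ j + 2 ^ j * (cmod (d j x))\<^sup>2)"
      by (rule summable_add[rotated])
    have "summable (\<lambda>j. d j x)"
    proof (rule summable_comparison_test[OF _ sm], intro exI[of _ 0] allI impI)
      fix j :: nat
      let ?c = "cmod (d j x)" and ?s = "sqrt (2 ^ j)"
      have "2 * (1 / ?s) * (?s * ?c) \<le> (1 / ?s)\<^sup>2 + (?s * ?c)\<^sup>2" by (rule sum_squares_bound)
      then have "2 * ?c \<le> (1 / 2) ^ j + 2 ^ j * ?c\<^sup>2"
        by (simp add: power_divide power_mult_distrib)
      then show "norm (d j x) \<le> (1 / 2) ^ j + 2 ^ j * ?c\<^sup>2"
        using norm_ge_zero[of "d j x"] by linarith
    qed
    then have "(\<lambda>j. \<Sum>i<j. d i x) \<longlonglongrightarrow> (\<Sum>i. d i x)"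
      by (rule summable_LIMSEQ)
    then have "(\<lambda>j. S (r j) x - S (r 0) x) \<longlonglongrightarrow> (\<Sum>i. d i x)"
      unfolding d_def sum_lessThan_telescope[of "\<lambda>j. S (r j) x"] .
    from tendsto_add[OF this tendsto_const[of "S (r 0) x"]]
    show "convergent (\<lambda>j. S (r j) x)" by (auto simp: convergent_def)
  qed
  define h where "h x = lim (\<lambda>j. S (r j) x)" for x
  have hm [measurable]: "h \<in> borel_measurable M"
    unfolding h_def by measurable
  have tail: "(\<integral>\<^sup>+x. ennreal ((cmod (S n x - h x))\<^sup>2) \<partial>M) \<le> ennreal e"
    if n: "n \<ge> K" and K: "\<forall>m\<ge>K. \<forall>n\<ge>K. (LINT x|M. (cmod (S m x - S n x))\<^sup>2) < e" for n K e
  proof -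
    have "(\<integral>\<^sup>+x. ennreal ((cmod (S n x - h x))\<^sup>2) \<partial>M)
          = (\<integral>\<^sup>+x. liminf (\<lambda>j. ennreal ((cmod (S n x - S (r j) x))\<^sup>2)) \<partial>M)"
    proof (rule nn_integral_cong_AE)
      show "AE x in M. ennreal ((cmod (S n x - h x))\<^sup>2) = liminf (\<lambda>j. ennreal ((cmod (S n x - S (r j) x))\<^sup>2))"
        using conv
      proof eventually_elim
        case (elim x)
        then have "(\<lambda>j. S (r j) x) \<longlonglongrightarrow> h x" by (simp add: h_def convergent_LIMSEQ_iff)
        then have "(\<lambda>j. ennreal ((cmod (S n x - S (r j) x))\<^sup>2)) \<longlonglongrightarrow> ennreal ((cmod (S n x - h x))\<^sup>2)"
          by (intro tendsto_ennrealI tendsto_intros)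
        from lim_imp_Liminf[OF trivial_limit_sequentially this] show ?case by (rule sym)
      qed
    qed
    also have "\<dots> \<le> liminf (\<lambda>j. \<integral>\<^sup>+x. ennreal ((cmod (S n x - S (r j) x))\<^sup>2) \<partial>M)"
      by (intro nn_integral_liminf) measurable
    also have "\<dots> \<le> liminf (\<lambda>j. ennreal e)"
    proof (rule Liminf_mono, rule eventually_sequentiallyI[of K])
      fix j assume "j \<ge> K"
      then have "r j \<ge> K" by (simp add: r_def)
      with K n have "(LINT x|M. (cmod (S n x - S (r j) x))\<^sup>2) < e" by blast
      then show "(\<integral>\<^sup>+x. ennreal ((cmod (S n x - S (r j) x))\<^sup>2) \<partial>M) \<le> ennreal e"
        by (subst nn_integral_sq) (auto intro: sq_integrable_diff S ennreal_leI)
    qed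
    also have "\<dots> = ennreal e" by (simp add: Liminf_const)
    finally show ?thesis .
  qed
  obtain K1 where K1: "\<forall>m\<ge>K1. \<forall>n\<ge>K1. (LINT x|M. (cmod (S m x - S n x))\<^sup>2) < 1"
    using Cauchy[of 1] by auto
  have "(\<lambda>x. S K1 x - h x) \<in> sq_integrable M"
    unfolding sq_integrable_def
  proof (intro CollectI conjI)
    show "integrable M (\<lambda>x. (cmod (S K1 x - h x))\<^sup>2)"
      using tail[OF order.refl K1] by (intro integrableI_bounded) (auto simp: le_less_trans)
  qed measurable
  from sq_integrable_diff[OF S[of K1] this] have h: "h \<in> sq_integrable M" by simp
  show thesis
  proof (rule that[OF h], rule LIMSEQ_I)
    fix e :: real assume "e > 0"
    then obtain K where K: "\<forall>m\<ge>K. \<forall>n\<ge>K. (LINT x|M. (cmod (S m x - S n x))\<^sup>2) < e / 2"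
      using Cauchy[of "e / 2"] by auto
    show "\<exists>K. \<forall>n\<ge>K. norm ((LINT x|M. (cmod (S n x - h x))\<^sup>2) - 0) < e"
    proof (intro exI[of _ K] allI impI)
      fix n assume "n \<ge> K"
      from tail[OF this K] have "ennreal (LINT x|M. (cmod (S n x - h x))\<^sup>2) \<le> ennreal (e / 2)"
        by (simp add: nn_integral_sq sq_integrable_diff S h)
      then have "(LINT x|M. (cmod (S n x - h x))\<^sup>2) \<le> e / 2" using \<open>e > 0\<close> by (simp add: ennreal_le_iff)
      then show "norm ((LINT x|M. (cmod (S n x - h x))\<^sup>2) - 0) < e" using \<open>e > 0\<close> by simp
    qed
  qed
qed

lemma orthogonal_sum_sq:
  assumes P: "\<And>k. P k \<in> sq_integrable M" and orth: "\<And>j k. j \<noteq> k \<Longrightarrow> sq_inner M (P j) (P k) = 0"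
    and "finite I"
  shows "(LINT x|M. (cmod (\<Sum>k\<in>I. c k * P k x))\<^sup>2) = (\<Sum>k\<in>I. (cmod (c k))\<^sup>2 * (LINT x|M. (cmod (P k x))\<^sup>2))"
proof -
  let ?S = "\<lambda>x. \<Sum>k\<in>I. c k * P k x"
  have S: "?S \<in> sq_integrable M" by (intro sq_integrable_sum sq_integrable_cmult P)
  have PS: "sq_inner M (P k) ?S = cnj (c k) * sq_inner M (P k) (P k)" if "k \<in> I" for k
  proof -
    have "sq_inner M (P k) ?S = cnj (\<Sum>j\<in>I. c j * sq_inner M (P j) (P k))"
      by (subst sq_inner_commute) (simp add: sq_inner_sum_left P)
    also have "(\<Sum>j\<in>I. c j * sq_inner M (P j) (P k)) = (\<Sum>j\<in>I. if j = k then c k * sq_inner M (P k) (P k) else 0)"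
      using orth by (intro sum.cong) auto
    also have "\<dots> = c k * sq_inner M (P k) (P k)" using that \<open>finite I\<close> by simp
    finally show ?thesis by (simp add: sq_inner_self)
  qed
  have "complex_of_real (LINT x|M. (cmod (?S x))\<^sup>2) = sq_inner M ?S ?S" by (simp add: sq_inner_self)
  also have "\<dots> = (\<Sum>k\<in>I. c k * sq_inner M (P k) ?S)"
    by (rule sq_inner_sum_left[OF P S])
  also have "\<dots> = (\<Sum>k\<in>I. c k * cnj (c k) * sq_inner M (P k) (P k))"
    by (intro sum.cong refl) (simp only: PS mult.assoc)
  also have "\<dots> = (\<Sum>k\<in>I. of_real ((cmod (c k))\<^sup>2 * (LINT x|M. (cmod (P k x))\<^sup>2)))"
    by (intro sum.cong refl) (simp add: sq_inner_self flip: complex_norm_square)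
  finally show ?thesis by (simp only: of_real_sum[symmetric] of_real_eq_iff)
qed

lemma Bessel_inequality:
  assumes P: "\<And>k. P k \<in> sq_integrable M" and orth: "\<And>j k. j \<noteq> k \<Longrightarrow> sq_inner M (P j) (P k) = 0"
    and u: "u \<in> sq_integrable M" and "finite I"
    and c: "\<And>k. c k * sq_inner M (P k) (P k) = sq_inner M u (P k)"
  shows "(\<Sum>k\<in>I. (cmod (c k))\<^sup>2 * (LINT x|M. (cmod (P k x))\<^sup>2)) \<le> (LINT x|M. (cmod (u x))\<^sup>2)"
proof -
  let ?S = "\<lambda>x. \<Sum>k\<in>I. c k * P k x"
  let ?N = "(\<Sum>k\<in>I. (cmod (c k))\<^sup>2 * (LINT x|M. (cmod (P k x))\<^sup>2))"
  have S: "?S \<in> sq_integrable M" by (intro sq_integrable_sum sq_integrable_cmult P)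
  have "sq_inner M ?S u = (\<Sum>k\<in>I. c k * sq_inner M (P k) u)"
    by (rule sq_inner_sum_left[OF P u])
  also have "\<dots> = (\<Sum>k\<in>I. of_real ((cmod (c k))\<^sup>2 * (LINT x|M. (cmod (P k x))\<^sup>2)))"
  proof (intro sum.cong refl)
    fix k
    have "sq_inner M (P k) u = cnj (c k * sq_inner M (P k) (P k))"
      unfolding c by (rule sq_inner_commute)
    then show "c k * sq_inner M (P k) u = of_real ((cmod (c k))\<^sup>2 * (LINT x|M. (cmod (P k x))\<^sup>2))"
      by (simp add: sq_inner_self flip: complex_norm_square)
  qed
  finally have Su: "sq_inner M ?S u = of_real ?N" by simp
  then have uS: "sq_inner M u ?S = of_real ?N"
    by (subst sq_inner_commute) simp
  have SS: "sq_inner M ?S ?S = of_real ?N"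
    unfolding sq_inner_self by (subst orthogonal_sum_sq[OF P orth \<open>finite I\<close>]) simp_all
  have D: "(\<lambda>x. u x - ?S x) \<in> sq_integrable M" by (intro sq_integrable_diff u S)
  have "complex_of_real (LINT x|M. (cmod (u x - ?S x))\<^sup>2) = sq_inner M (\<lambda>x. u x - ?S x) (\<lambda>x. u x - ?S x)"
    by (simp add: sq_inner_self)
  also have "\<dots> = sq_inner M u (\<lambda>x. u x - ?S x) - sq_inner M ?S (\<lambda>x. u x - ?S x)"
    by (rule sq_inner_diff_left[OF u S D])
  also have "\<dots> = (sq_inner M u u - of_real ?N) - (of_real ?N - of_real ?N)"
    using sq_inner_lincomb_right[OF u S u, of 1 "-1"] sq_inner_lincomb_right[OF u S S, of 1 "-1"]
    by (simp add: uS Su SS)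
  finally have "complex_of_real (LINT x|M. (cmod (u x - ?S x))\<^sup>2)
      = of_real ((LINT x|M. (cmod (u x))\<^sup>2) - ?N)"
    by (simp only: sq_inner_self of_real_diff diff_self diff_zero)
  then have "(LINT x|M. (cmod (u x - ?S x))\<^sup>2) = (LINT x|M. (cmod (u x))\<^sup>2) - ?N"
    by (simp only: of_real_eq_iff)
  moreover have "(LINT x|M. (cmod (u x - ?S x))\<^sup>2) \<ge> 0" by simp
  ultimately show ?thesis by linarith
qed

text \<open>
  Blocks of the series have squared norms that are blocks of a convergent series, so the partial sums
  form a Cauchy sequence. Only weak convergence to the sum is recorded.
\<close>
lemma orthogonal_series:
  assumes P: "\<And>k. P k \<in> sq_integrable M" and orth: "\<And>j k. j \<noteq> k \<Longrightarrow> sq_inner M (P j) (P k) = 0"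
    and bound: "\<And>n. (\<Sum>k<n. (cmod (c k))\<^sup>2 * (LINT x|M. (cmod (P k x))\<^sup>2)) \<le> B"
  obtains h where "h \<in> sq_integrable M"
    "\<And>g. g \<in> sq_integrable M \<Longrightarrow> (\<lambda>k. c k * sq_inner M (P k) g) sums sq_inner M h g"
proof -
  define b where "b k = (cmod (c k))\<^sup>2 * (LINT x|M. (cmod (P k x))\<^sup>2)" for k
  have "summable b"
  proof (rule bounded_imp_summable)
    show "(\<Sum>k\<le>n. b k) \<le> B" for n
      using bound[of "Suc n"] by (simp only: b_def lessThan_Suc_atMost)
  qed (simp add: b_def)
  define S where "S n x = (\<Sum>k<n. c k * P k x)" for n x
  have S: "S n \<in> sq_integrable M" for n
    unfolding S_def by (intro sq_integrable_sum sq_integrable_cmult P)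
  have diff: "(LINT x|M. (cmod (S m x - S n x))\<^sup>2) = (\<Sum>k\<in>{n..<m}. b k)" if "n \<le> m" for m n
  proof -
    have "S m x - S n x = (\<Sum>k\<in>{n..<m}. c k * P k x)" for x
      unfolding S_def using that by (simp add: sum_diff_nat_ivl flip: atLeast0LessThan)
    then show ?thesis unfolding b_def by (simp add: orthogonal_sum_sq[OF P orth])
  qed
  have sym: "(LINT x|M. (cmod (S m x - S n x))\<^sup>2) = (LINT x|M. (cmod (S n x - S m x))\<^sup>2)" for m n
    by (simp add: norm_minus_commute)
  have "\<exists>N. \<forall>m\<ge>N. \<forall>n\<ge>N. (LINT x|M. (cmod (S m x - S n x))\<^sup>2) < e" if e: "e > 0" for e
  proof -
    obtain N where N: "\<And>m n. m \<ge> N \<Longrightarrow> norm (sum b {m..<n}) < e"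
      using \<open>summable b\<close> e unfolding summable_Cauchy by blast
    show ?thesis
    proof (intro exI[of _ N] allI impI)
      fix m n assume "N \<le> m" "N \<le> n"
      with N[of n m] N[of m n] show "(LINT x|M. (cmod (S m x - S n x))\<^sup>2) < e"
        by (cases "n \<le> m") (auto simp: diff, auto simp: sym[of m n] diff)
    qed
  qed
  from Riesz_Fischer[OF S this] obtain h where h: "h \<in> sq_integrable M"
    "(\<lambda>n. LINT x|M. (cmod (S n x - h x))\<^sup>2) \<longlonglongrightarrow> 0" by blast
  show thesis
  proof (rule that[OF h(1)])
    fix g assume g: "g \<in> sq_integrable M"
    have "sq_inner M (S n) g = (\<Sum>k<n. c k * sq_inner M (P k) g)" for n
      unfolding S_def by (rule sq_inner_sum_left[OF P g])
    with sq_inner_tendsto[OF S h(1) g h(2)] show "(\<lambda>k. c k * sq_inner M (P k) g) sums sq_inner M h g"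
      by (simp add: sums_def)
  qed
qed

section \<open>Selecting functionals that separate points\<close>

text \<open>
  Choose a functional that does not vanish on \<open>V\<close> and pass to its kernel, whose dimension is smaller
  by one and on which the family still separates points. In a vanishing linear combination of the
  functionals selected this way, restriction to the kernel removes the last one, so that the other
  coefficients vanish by induction, and with them the last.
\<close>
lemma (in vector_space) separating_functionals_select:
  fixes \<phi> :: "'k \<Rightarrow> 'b \<Rightarrow> 'a"
  assumes "finite B" "independent B" "card B = m" "V = span B"
    and add: "\<And>k x y. \<lbrakk>x \<in> V; y \<in> V\<rbrakk> \<Longrightarrow> \<phi> k (x + y) = \<phi> k x + \<phi> k y"
    and mult: "\<And>k c x. x \<in> V \<Longrightarrow> \<phi> k (scale c x) = c * \<phi> k x"
    and sep: "\<And>x. \<lbrakk>x \<in> V; \<And>k. \<phi> k x = 0\<rbrakk> \<Longrightarrow> x = 0"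
  shows "\<exists>\<kappa> :: nat \<Rightarrow> 'k. (\<forall>x\<in>V. (\<forall>i\<in>{1..m}. \<phi> (\<kappa> i) x = 0) \<longrightarrow> x = 0) \<and>
     (\<forall>\<alpha>. (\<forall>x\<in>V. (\<Sum>i=1..m. \<alpha> i * \<phi> (\<kappa> i) x) = 0) \<longrightarrow> (\<forall>i\<in>{1..m}. \<alpha> i = 0))"
  using assms
proof (induction m arbitrary: V B)
  case 0
  then have "V = {0}" by simp
  then show ?case by auto
next
  case (Suc m)
  note add = Suc.prems(5) and mult = Suc.prems(6) and sep = Suc.prems(7)
  have V: "subspace V" using Suc.prems by simp
  have "B \<noteq> {}" using Suc.prems(3) by auto
  then obtain b where b: "b \<in> B" by blast
  with Suc.prems have "b \<noteq> 0" "b \<in> V" using dependent_zero span_base by auto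
  with sep obtain k0 where k0: "\<phi> k0 b \<noteq> 0" by blast
  define W where "W = {x \<in> V. \<phi> k0 x = 0}"
  have W: "subspace W"
    using V mult[of 0 k0 0] by (auto simp: subspace_def W_def add mult)
  obtain B' where B': "B' \<subseteq> W" "independent B'" "W \<subseteq> span B'" "card B' = dim W"
    using basis_exists by blast
  have spB': "span B' = W" using B' W by (metis span_minimal subset_antisym)
  have b_notin: "b \<notin> span B'" using spB' k0 by (simp add: W_def)
  have ind: "independent (insert b B')" using B'(2) b_notin by (rule independent_insertI[rotated])
  have "insert b B' \<subseteq> V" using B' \<open>b \<in> V\<close> by (auto simp: W_def)
  have fin: "finite (insert b B')"
    using independent_span_bound[OF Suc.prems(1) ind] \<open>insert b B' \<subseteq> V\<close> Suc.prems(4) by auto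
  have spV: "span (insert b B') = V"
  proof
    show "span (insert b B') \<subseteq> V" using \<open>insert b B' \<subseteq> V\<close> V by (rule span_minimal)
    show "V \<subseteq> span (insert b B')"
    proof
      fix x assume x: "x \<in> V"
      define c where "c = \<phi> k0 x / \<phi> k0 b"
      have "x - scale c b = x + scale (- c) b" by simp
      moreover have "scale (- c) b \<in> V" using \<open>b \<in> V\<close> V by (rule subspace_scale[rotated])
      moreover have "\<phi> k0 (x + scale (- c) b) = \<phi> k0 x + - c * \<phi> k0 b"
        using x \<open>b \<in> V\<close> \<open>scale (- c) b \<in> V\<close> by (simp only: add mult)
      moreover have "\<dots> = 0" using k0 by (simp add: c_def)
      ultimately have "x - scale c b \<in> W"
        using subspace_add[OF V x \<open>scale (- c) b \<in> V\<close>] by (simp only: W_def mem_Collect_eq simp_thms)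
      then show "x \<in> span (insert b B')" using spB' by (auto simp: span_insert)
    qed
  qed
  have "card (insert b B') = card B"
    using spV Suc.prems fin ind by (metis dim_span dim_eq_card_independent)
  moreover have "b \<notin> B'" using b_notin span_base by blast
  ultimately have "card B' = m" using fin Suc.prems(3) by simp
  moreover have "finite B'" using fin by simp
  ultimately obtain \<kappa> where \<kappa>: "\<forall>x\<in>W. (\<forall>i\<in>{1..m}. \<phi> (\<kappa> i) x = 0) \<longrightarrow> x = 0"
    "\<forall>\<alpha>. (\<forall>x\<in>W. (\<Sum>i=1..m. \<alpha> i * \<phi> (\<kappa> i) x) = 0) \<longrightarrow> (\<forall>i\<in>{1..m}. \<alpha> i = 0)"
    using Suc.IH[of B' W] B'(2) spB' add mult sep by (auto simp: W_def)
  define \<kappa>' where "\<kappa>' = \<kappa>(Suc m := k0)"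
  show ?case
  proof (intro exI[of _ \<kappa>'] conjI ballI allI impI)
    fix x assume x: "x \<in> V" "\<forall>i\<in>{1..Suc m}. \<phi> (\<kappa>' i) x = 0"
    have "\<phi> k0 x = 0" using x(2) by (auto simp: \<kappa>'_def dest: bspec[of _ _ "Suc m"])
    moreover have "\<phi> (\<kappa> i) x = 0" if "i \<in> {1..m}" for i
      using x(2) that by (auto simp: \<kappa>'_def dest!: bspec[of _ _ i])
    ultimately show "x = 0" using \<kappa>(1) x(1) by (auto simp: W_def)
  next
    fix \<alpha> i assume \<alpha>: "\<forall>x\<in>V. (\<Sum>i=1..Suc m. \<alpha> i * \<phi> (\<kappa>' i) x) = 0" and i: "i \<in> {1..Suc m}"
    have split: "(\<Sum>i=1..m. \<alpha> i * \<phi> (\<kappa> i) x) + \<alpha> (Suc m) * \<phi> k0 x = 0" if "x \<in> V" for x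
    proof -
      have "(\<Sum>i=1..m. \<alpha> i * \<phi> (\<kappa>' i) x) = (\<Sum>i=1..m. \<alpha> i * \<phi> (\<kappa> i) x)"
        by (intro sum.cong) (auto simp: \<kappa>'_def)
      with \<alpha> that show ?thesis by (simp add: \<kappa>'_def)
    qed
    have "(\<Sum>i=1..m. \<alpha> i * \<phi> (\<kappa> i) x) = 0" if "x \<in> W" for x
      using split[of x] that by (simp add: W_def)
    with \<kappa>(2) have 0: "\<forall>i\<in>{1..m}. \<alpha> i = 0" by blast
    with split[OF \<open>b \<in> V\<close>] k0 have "\<alpha> (Suc m) = 0" by simp
    with 0 i show "\<alpha> i = 0" by (cases "i = Suc m") auto
  qed
qed

section \<open>The weighted space as an \<open>L\<^sup>2\<close> space of a measure\<close>

locale weighted_interval =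
  fixes a b :: ereal and p q w :: "real \<Rightarrow> real"
  assumes ab: "a < b" and coefficients: "sl_coefficients a b p q w"
begin

text \<open>
  Integration against \<open>w\<close> on \<open>(a,b)\<close>. As \<open>w > 0\<close> almost everywhere there, its null sets are the
  Lebesgue null sets.
\<close>
definition M :: "real measure" where
  "M = density (lebesgue_on (einterval a b)) (\<lambda>x. ennreal (w x))"

text \<open>
  Local integrability makes \<open>w\<close> measurable on each compact subinterval, and \<open>(a,b)\<close> is an
  increasing union of countably many of these.
\<close>
lemma weight_measurable: "w \<in> borel_measurable (lebesgue_on (einterval a b))"
proof -
  obtain u l :: "nat \<Rightarrow> real" where ul: "einterval a b = (\<Union>i. {l i..u i})" "incseq u" "decseq l"
    "\<And>i. l i < u i" "\<And>i. a < l i" "\<And>i. u i < b"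
    by (rule einterval_Icc_approximation[OF ab]) (rule that)
  have "(\<lambda>x. indicator {l i..u i} x *\<^sub>R w x) \<in> borel_measurable lebesgue" for i
  proof -
    have "w absolutely_integrable_on {l i..u i}"
      using coefficients ul(4-6)[of i] by (auto simp: sl_coefficients_def L1_loc_def less_imp_le)
    then show ?thesis by (auto simp: set_integrable_def)
  qed
  then have "(\<lambda>x. indicator (einterval a b) x *\<^sub>R w x) \<in> borel_measurable lebesgue"
  proof (rule borel_measurable_LIMSEQ_metric)
    fix x
    show "(\<lambda>i. indicator {l i..u i} x *\<^sub>R w x) \<longlonglongrightarrow> indicator (einterval a b) x *\<^sub>R w x"
    proof (cases "x \<in> einterval a b")
      case True
      then obtain i where i: "x \<in> {l i..u i}" using ul(1) by auto
      have "x \<in> {l j..u j}" if "j \<ge> i" for j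
        using i incseqD[OF ul(2) that] decseqD[OF ul(3) that] by auto
      then have "\<forall>\<^sub>F j in sequentially. indicator {l j..u j} x *\<^sub>R w x = indicator (einterval a b) x *\<^sub>R w x"
        using True by (intro eventually_sequentiallyI[of i]) auto
      then show ?thesis by (rule tendsto_eventually)
    next
      case False
      then have "x \<notin> {l j..u j}" for j using ul(1) by auto
      with False show ?thesis by simp
    qed
  qed
  then show ?thesis by (simp add: borel_measurable_restrict_space_iff)
qed

lemma weight_pos: "AE x in lebesgue_on (einterval a b). 0 < w x"
  using coefficients by (subst AE_restrict_space_iff) (auto simp: sl_coefficients_def elim: eventually_mono)

lemma measurable_M: "f \<in> borel_measurable M \<longleftrightarrow> set_borel_measurable lebesgue (einterval a b) f"
  for f :: "real \<Rightarrow> 'b::real_normed_vector"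
proof -
  have "f \<in> borel_measurable M \<longleftrightarrow> f \<in> borel_measurable (lebesgue_on (einterval a b))"
    by (simp add: M_def)
  then show ?thesis
    by (simp add: borel_measurable_restrict_space_iff set_borel_measurable_def)
qed

lemma L2_eq: "L2 a b w = sq_integrable M"
proof -
  have "integrable M (\<lambda>x. (cmod (f x))\<^sup>2) \<longleftrightarrow> set_integrable lebesgue (einterval a b) (\<lambda>x. (cmod (f x))\<^sup>2 * w x)"
    if "f \<in> borel_measurable M" for f
  proof -
    have "integrable M (\<lambda>x. (cmod (f x))\<^sup>2) \<longleftrightarrow> integrable (lebesgue_on (einterval a b)) (\<lambda>x. w x *\<^sub>R (cmod (f x))\<^sup>2)"
      unfolding M_def using that weight_measurable weight_pos
      by (intro integrable_density) (auto simp: M_def elim: eventually_mono)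
    then show ?thesis
      by (simp add: integrable_restrict_space set_integrable_def mult.commute)
  qed
  then show ?thesis
    unfolding L2_def sq_integrable_def using measurable_M by blast
qed

lemma integral_M:
  fixes F :: "real \<Rightarrow> complex"
  assumes F: "F \<in> borel_measurable M"
  shows "(LINT x=a..b|lebesgue. (F x * of_real (w x))) = (LINT x|M. F x)"
proof -
  have "(LINT x|M. F x) = (LINT x|lebesgue_on (einterval a b). w x *\<^sub>R F x)"
    unfolding M_def using F weight_measurable weight_pos
    by (intro integral_density) (auto simp: M_def elim: eventually_mono)
  also have "\<dots> = (LINT x:einterval a b|lebesgue. (F x * of_real (w x)))"
    by (simp add: integral_restrict_space set_lebesgue_integral_def scaleR_conv_of_real mult.commute)
  also have "\<dots> = (LINT x=a..b|lebesgue. (F x * of_real (w x)))"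
    using ab by (simp add: interval_lebesgue_integral_def less_imp_le)
  finally show ?thesis by simp
qed

lemma ae_eq_iff: "ae_eq a b f g \<longleftrightarrow> (AE x in M. f x = g x)"
proof -
  have "(AE x in M. f x = g x) \<longleftrightarrow> (AE x in lebesgue_on (einterval a b). 0 < ennreal (w x) \<longrightarrow> f x = g x)"
    unfolding M_def using weight_measurable by (intro AE_density) auto
  also have "\<dots> \<longleftrightarrow> (AE x in lebesgue_on (einterval a b). f x = g x)"
    by (rule eventually_subst) (use weight_pos in eventually_elim, simp)
  finally show ?thesis by (simp add: ae_eq_def AE_restrict_space_iff)
qed

text \<open>Measurability is inherited because Lebesgue measure is complete.\<close>
lemma L2_cong:
  assumes f: "f \<in> L2 a b w" and ae: "ae_eq a b f g"
  shows "g \<in> L2 a b w"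
proof -
  have fm: "(\<lambda>x. indicator (einterval a b) x *\<^sub>R f x) \<in> borel_measurable lebesgue"
    using f by (simp add: L2_def set_borel_measurable_def)
  have ae': "AE x in lebesgue. indicator (einterval a b) x *\<^sub>R f x = indicator (einterval a b) x *\<^sub>R g x"
    using ae unfolding ae_eq_def by eventually_elim (auto simp: indicator_def)
  have "(\<lambda>x. indicator (einterval a b) x *\<^sub>R g x) \<in> borel_measurable lebesgue"
  proof (rule measurableI)
    fix S :: "complex set" assume "S \<in> sets borel"
    show "(\<lambda>x. indicator (einterval a b) x *\<^sub>R g x) -` S \<inter> space lebesgue \<in> sets lebesgue"
    proof (rule completion.in_sets_AE)
      show "(\<lambda>x. indicator (einterval a b) x *\<^sub>R f x) -` S \<inter> space lebesgue \<in> sets lebesgue"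
        using fm \<open>S \<in> sets borel\<close> by (rule measurable_sets)
      show "AE x in lebesgue. (x \<in> (\<lambda>x. indicator (einterval a b) x *\<^sub>R f x) -` S \<inter> space lebesgue) =
          (x \<in> (\<lambda>x. indicator (einterval a b) x *\<^sub>R g x) -` S \<inter> space lebesgue)"
        using ae' by eventually_elim (simp only: vimage_def Int_iff mem_Collect_eq)
    qed simp
  qed simp
  then have g: "g \<in> borel_measurable M"
    by (simp add: measurable_M set_borel_measurable_def)
  have "integrable M (\<lambda>x. (cmod (f x))\<^sup>2)" "f \<in> borel_measurable M"
    using f by (auto simp: L2_eq sq_integrable_def)
  moreover have "AE x in M. (cmod (g x))\<^sup>2 = (cmod (f x))\<^sup>2"
    using ae unfolding ae_eq_iff by eventually_elim simp
  ultimately have "integrable M (\<lambda>x. (cmod (g x))\<^sup>2)"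
    using g by (subst integrable_cong_AE[of _ _ "\<lambda>x. (cmod (f x))\<^sup>2"]) auto
  with g show ?thesis by (simp add: L2_eq sq_integrable_def)
qed

lemma L2_inner_eq:
  assumes "f \<in> L2 a b w" "g \<in> L2 a b w"
  shows "L2_inner a b w f g = sq_inner M f g"
proof -
  have "(\<lambda>x. f x * cnj (g x)) \<in> borel_measurable M"
    using assms unfolding L2_eq by measurable
  from integral_M[OF this] show ?thesis by (simp add: L2_inner_def sq_inner_def)
qed

lemma sq_inner_cong_ae_eq:
  assumes "ae_eq a b f f'" "ae_eq a b g g'" "f \<in> L2 a b w" "g \<in> L2 a b w"
  shows "sq_inner M f g = sq_inner M f' g'"
  using assms L2_cong[OF assms(3,1)] L2_cong[OF assms(4,2)]
  by (intro sq_inner_cong) (auto simp: ae_eq_iff L2_eq sq_integrable_def)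

lemma L2_bounded_linear:
  fixes \<Lambda> :: "complex \<times> complex \<Rightarrow> complex"
  assumes "bounded_linear \<Lambda>" "f \<in> L2 a b w" "g \<in> L2 a b w"
  shows "(\<lambda>x. \<Lambda> (f x, g x)) \<in> L2 a b w"
  using sq_integrable_bounded_linear[OF assms(1)] assms(2,3) by (simp add: L2_eq)

end

section \<open>The maximal domain and its boundary form\<close>

locale sl_power = weighted_interval +
  fixes n :: nat
begin

abbreviation T :: "cfun \<Rightarrow> cfun" where "T \<equiv> sl_pow a b p q w n"
abbreviation Dom :: "cfun set" where "Dom \<equiv> D_max a b p q w n"
abbreviation bracket :: "cfun \<Rightarrow> cfun \<Rightarrow> complex" where "bracket \<equiv> sl_bracket a b p q w n"

lemma Dom_L2: "f \<in> Dom \<Longrightarrow> f \<in> sq_integrable M" "f \<in> Dom \<Longrightarrow> T f \<in> sq_integrable M"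
  by (auto simp: D_max_def L2_eq)

lemma Dom_bounded_linear:
  fixes \<Lambda> :: "complex \<times> complex \<Rightarrow> complex"
  assumes \<Lambda>: "bounded_linear \<Lambda>" and f: "f \<in> Dom" and g: "g \<in> Dom"
  shows "(\<lambda>x. \<Lambda> (f x, g x)) \<in> Dom" "ae_eq a b (T (\<lambda>x. \<Lambda> (f x, g x))) (\<lambda>x. \<Lambda> (T f x, T g x))"
proof -
  show ae: "ae_eq a b (T (\<lambda>x. \<Lambda> (f x, g x))) (\<lambda>x. \<Lambda> (T f x, T g x))"
    using f g by (intro sl_pow_bounded_linear \<Lambda>) (auto simp: D_max_def sl_dom_def)
  show "(\<lambda>x. \<Lambda> (f x, g x)) \<in> Dom"
    using f g \<Lambda> L2_bounded_linear[OF \<Lambda>] L2_cong[OF _ ae_eq_sym[OF ae]] sl_dom_bounded_linear[OF \<Lambda>]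
    by (auto simp: D_max_def)
qed

lemma Dom_lincomb:
  assumes f: "f \<in> Dom" and g: "g \<in> Dom"
  shows "(\<lambda>x. c * f x + d * g x) \<in> Dom" "ae_eq a b (T (\<lambda>x. c * f x + d * g x)) (\<lambda>x. c * T f x + d * T g x)"
proof -
  have "bounded_linear (\<lambda>z. c * fst z + d * snd z)"
    by (intro bounded_linear_intros)
  from Dom_bounded_linear[OF this f g]
  show "(\<lambda>x. c * f x + d * g x) \<in> Dom" "ae_eq a b (T (\<lambda>x. c * f x + d * g x)) (\<lambda>x. c * T f x + d * T g x)"
    by simp_all
qed

text \<open>
  The form is defined through \<open>\<ell>\<close> applied to the conjugate of \<open>g\<close>; commuting \<open>\<ell>\<close> with conjugation
  turns it into the defect of symmetry of \<open>\<ell>\<close>, and makes it skew-Hermitian.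
\<close>
lemma bracket_eq:
  assumes f: "f \<in> Dom" and g: "g \<in> Dom"
  shows "bracket f g = sq_inner M (T f) g - sq_inner M f (T g)"
proof -
  have bl: "bounded_linear (\<lambda>z :: complex \<times> complex. cnj (snd z))"
    by (intro bounded_linear_compose[OF bounded_linear_cnj] bounded_linear_snd)
  have gD: "(\<lambda>x. cnj (g x)) \<in> Dom" and Tg: "ae_eq a b (T (\<lambda>x. cnj (g x))) (\<lambda>x. cnj (T g x))"
    using Dom_bounded_linear[OF bl g g] by simp_all
  have [measurable]: "f \<in> borel_measurable M" "T f \<in> borel_measurable M" "g \<in> borel_measurable M"
    "T g \<in> borel_measurable M" "T (\<lambda>x. cnj (g x)) \<in> borel_measurable M"
    using Dom_L2[OF f] Dom_L2[OF g] Dom_L2[OF gD] by (auto simp: sq_integrable_def)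
  have "bracket f g = (LINT x|M. T f x * cnj (g x) - T (\<lambda>t. cnj (g t)) x * f x)"
    unfolding sl_bracket_def by (rule integral_M) measurable
  also have "\<dots> = (LINT x|M. T f x * cnj (g x) - f x * cnj (T g x))"
  proof (rule integral_cong_AE)
    show "AE x in M. T f x * cnj (g x) - T (\<lambda>t. cnj (g t)) x * f x = T f x * cnj (g x) - f x * cnj (T g x)"
      using Tg unfolding ae_eq_iff by eventually_elim simp
  qed measurable
  also have "\<dots> = sq_inner M (T f) g - sq_inner M f (T g)"
    unfolding sq_inner_def using Dom_L2[OF f] Dom_L2[OF g]
    by (intro Bochner_Integration.integral_diff sq_integrable_mult)
  finally show ?thesis .
qed

lemma bracket_lincomb_left:
  assumes f: "f \<in> Dom" and g: "g \<in> Dom" and h: "h \<in> Dom"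
  shows "bracket (\<lambda>x. c * f x + d * g x) h = c * bracket f h + d * bracket g h"
proof -
  have "sq_inner M (T (\<lambda>x. c * f x + d * g x)) h = sq_inner M (\<lambda>x. c * T f x + d * T g x) h"
    using Dom_lincomb[OF f g, of c d] Dom_L2[OF h] Dom_L2(2)[OF Dom_lincomb(1)[OF f g, of c d]]
    by (intro sq_inner_cong_ae_eq) (auto simp: L2_eq)
  then show ?thesis
    using Dom_L2[OF f] Dom_L2[OF g] Dom_L2[OF h]
    by (simp add: bracket_eq Dom_lincomb(1) f g h sq_inner_lincomb_left algebra_simps)
qed

lemma bracket_commute:
  assumes f: "f \<in> Dom" and g: "g \<in> Dom"
  shows "bracket g f = - cnj (bracket f g)"
  using sq_inner_commute[of M "T f" g] sq_inner_commute[of M f "T g"] by (simp add: bracket_eq f g)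

lemma Dom_sum:
  assumes "finite I" and f: "\<And>i. i \<in> I \<Longrightarrow> f i \<in> Dom" and g: "g \<in> Dom"
  shows "(\<lambda>x. \<Sum>i\<in>I. c i * f i x) \<in> Dom \<and> bracket (\<lambda>x. \<Sum>i\<in>I. c i * f i x) g = (\<Sum>i\<in>I. c i * bracket (f i) g)"
  using assms(1) f
proof (induction I)
  case empty
  show ?case using Dom_lincomb(1)[OF g g, of 0 0] bracket_lincomb_left[OF g g g, of 0 0] by simp
next
  case (insert i I)
  then have D: "f i \<in> Dom" "(\<lambda>x. \<Sum>i\<in>I. c i * f i x) \<in> Dom" by auto
  show ?case
    using Dom_lincomb(1)[OF D, of "c i" 1] bracket_lincomb_left[OF D g, of "c i" 1] insert by simp
qed

end

section \<open>Self-adjoint realizations with a complete system of eigenfunctions\<close>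

locale self_adjoint_realization = sl_power +
  fixes D_L :: "cfun set" and P :: "nat \<Rightarrow> cfun" and c :: "nat \<Rightarrow> complex"
  assumes DL: "D_L \<subseteq> D_max a b p q w n"
    and sa: "self_adjoint_op a b w (op_of a b w (sl_pow a b p q w n) D_L)"
    and P: "\<And>k. P k \<in> D_L"
    and eigen: "\<And>k. ae_eq a b (sl_pow a b p q w n (P k)) (\<lambda>x. c k * P k x)"
    and complete: "complete_orthogonal a b w P"
begin

lemma DL_Dom: "f \<in> D_L \<Longrightarrow> f \<in> Dom"
  using DL by blast

lemma in_graph: "f \<in> D_L \<Longrightarrow> (f, T f) \<in> op_of a b w T D_L"
  using Dom_L2[OF DL_Dom] by (auto simp: op_of_def L2_eq intro!: bexI[of _ f])

lemma symmetric:
  assumes f: "f \<in> D_L" and g: "g \<in> D_L"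
  shows "sq_inner M (T f) g = sq_inner M f (T g)"
proof -
  have "(g, T g) \<in> adjoint_op a b w (op_of a b w T D_L)"
    using in_graph[OF g] sa by (simp add: self_adjoint_op_def)
  then have "L2_inner a b w (T f) g = L2_inner a b w f (T g)"
    using in_graph[OF f] unfolding adjoint_op_def by blast
  then show ?thesis
    using Dom_L2[OF DL_Dom[OF f]] Dom_L2[OF DL_Dom[OF g]] by (simp add: L2_inner_eq L2_eq)
qed

lemma bracket_D_L: "\<lbrakk>f \<in> D_L; g \<in> D_L\<rbrakk> \<Longrightarrow> bracket f g = 0"
  by (simp add: bracket_eq DL_Dom symmetric)

lemma adjoint_in_domain:
  assumes h: "h \<in> sq_integrable M" and v: "v \<in> sq_integrable M"
    and adj: "\<And>f. f \<in> D_L \<Longrightarrow> sq_inner M (T f) h = sq_inner M f v"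
  obtains h' where "h' \<in> D_L" "ae_eq a b h h'" "ae_eq a b v (T h')"
proof -
  have "L2_inner a b w g' h = L2_inner a b w g v" if g: "(g, g') \<in> op_of a b w T D_L" for g g'
  proof -
    obtain f where f: "f \<in> D_L" "ae_eq a b g f" "ae_eq a b g' (T f)" and L2: "g \<in> L2 a b w" "g' \<in> L2 a b w"
      using g by (auto simp: op_of_def)
    have "sq_inner M g' h = sq_inner M (T f) h" "sq_inner M g v = sq_inner M f v"
      using f L2 h v by (auto intro!: sq_inner_cong_ae_eq simp: L2_eq)
    with adj[OF f(1)] L2 h v show ?thesis by (simp add: L2_inner_eq L2_eq)
  qed
  then have "(h, v) \<in> adjoint_op a b w (op_of a b w T D_L)"
    using h v by (auto simp: adjoint_op_def L2_eq)
  then have "(h, v) \<in> op_of a b w T D_L"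
    using sa by (simp add: self_adjoint_op_def)
  then show thesis using that by (auto simp: op_of_def)
qed

lemma P_L2: "P k \<in> sq_integrable M"
  using complete by (simp add: complete_orthogonal_def L2_eq)

lemma P_orthogonal: "j \<noteq> k \<Longrightarrow> sq_inner M (P j) (P k) = 0"
  using complete P_L2 by (simp add: complete_orthogonal_def L2_inner_eq L2_eq)

lemma P_norm: "sq_inner M (P k) (P k) \<noteq> 0"
  using complete P_L2 by (simp add: complete_orthogonal_def ae_eq_iff sq_inner_self_eq_0)

lemma P_complete:
  assumes "f \<in> sq_integrable M" "\<And>k. sq_inner M f (P k) = 0"
  shows "ae_eq a b f (\<lambda>x. 0)"
  using complete assms P_L2 by (simp add: complete_orthogonal_def L2_inner_eq L2_eq)

lemma T_P:
  assumes g: "g \<in> sq_integrable M"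
  shows "sq_inner M (T (P k)) g = c k * sq_inner M (P k) g" "sq_inner M g (T (P k)) = cnj (c k) * sq_inner M g (P k)"
proof -
  have "sq_inner M (T (P k)) g = sq_inner M (\<lambda>x. c k * P k x) g"
    using eigen Dom_L2[OF DL_Dom[OF P]] g by (intro sq_inner_cong_ae_eq) (auto simp: L2_eq)
  then show *: "sq_inner M (T (P k)) g = c k * sq_inner M (P k) g"
    by (simp add: sq_inner_cmult_left P_L2 g)
  show "sq_inner M g (T (P k)) = cnj (c k) * sq_inner M g (P k)"
    using * sq_inner_commute[of M g "T (P k)"] sq_inner_commute[of M g "P k"] by simp
qed

lemma eigenvalue_real: "cnj (c k) = c k"
  using symmetric[OF P P, of k k] P_norm[of k] by (simp add: T_P P_L2)

text \<open>
  By these bounds the factors \<open>1 / (c k - \<i>)\<close> and \<open>c k / (c k - \<i>)\<close> preserve square summability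
  of coefficients.
\<close>
lemma norm_eigenvalue_minus_i: "1 \<le> cmod (c k - \<i>)" "cmod (c k) \<le> cmod (c k - \<i>)"
proof -
  have "Im (c k) = 0" using arg_cong[OF eigenvalue_real[of k], of Im] by simp
  then have "(cmod (c k - \<i>))\<^sup>2 = (Re (c k))\<^sup>2 + 1" "(cmod (c k))\<^sup>2 = (Re (c k))\<^sup>2"
    by (simp_all add: cmod_power2)
  then have "1\<^sup>2 \<le> (cmod (c k - \<i>))\<^sup>2" "(cmod (c k))\<^sup>2 \<le> (cmod (c k - \<i>))\<^sup>2" by simp_all
  then show "1 \<le> cmod (c k - \<i>)" "cmod (c k) \<le> cmod (c k - \<i>)"
    by (auto intro: power2_le_imp_le)
qed

text \<open>
  With \<open>\<beta> k\<close> the Fourier coefficients of \<open>u\<close>, the series of the \<open>\<beta> k / (c k - \<i>)\<close> and of the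
  \<open>c k * \<beta> k / (c k - \<i>)\<close> have sums \<open>h\<close> and \<open>v\<close>. Termwise, \<open>\<langle>L f, h\<rangle> = \<langle>f, v\<rangle>\<close> for \<open>f\<close> in the
  domain, so that \<open>v = L h\<close> by self-adjointness. The equation \<open>(L - \<i>) h = u\<close> is then checked on
  coefficients.
\<close>
lemma resolvent:
  assumes u: "u \<in> sq_integrable M"
  obtains h where "h \<in> D_L" "ae_eq a b (\<lambda>x. T h x - \<i> * h x) u"
proof -
  define \<beta> where "\<beta> k = sq_inner M u (P k) / sq_inner M (P k) (P k)" for k
  have \<beta>: "\<beta> k * sq_inner M (P k) (P k) = sq_inner M u (P k)" for k
    using P_norm by (simp add: \<beta>_def)
  have ne: "c k - \<i> \<noteq> 0" for k using norm_eigenvalue_minus_i(1)[of k] by auto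
  have bound: "(\<Sum>k<m. (cmod (s k * \<beta> k))\<^sup>2 * (LINT x|M. (cmod (P k x))\<^sup>2)) \<le> (LINT x|M. (cmod (u x))\<^sup>2)"
    if s: "\<And>k. cmod (s k) \<le> 1" for s :: "nat \<Rightarrow> complex" and m
  proof -
    have "cmod (s k * \<beta> k) \<le> cmod (\<beta> k)" for k
      using mult_right_mono[OF s[of k], of "cmod (\<beta> k)"] by (simp add: norm_mult)
    then have "(\<Sum>k<m. (cmod (s k * \<beta> k))\<^sup>2 * (LINT x|M. (cmod (P k x))\<^sup>2))
        \<le> (\<Sum>k<m. (cmod (\<beta> k))\<^sup>2 * (LINT x|M. (cmod (P k x))\<^sup>2))"
      by (intro sum_mono mult_right_mono power_mono) auto
    also have "\<dots> \<le> (LINT x|M. (cmod (u x))\<^sup>2)"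
      by (intro Bessel_inequality P_L2 P_orthogonal u \<beta>) auto
    finally show ?thesis .
  qed
  have le1: "cmod (1 / (c k - \<i>)) \<le> 1" "cmod (c k / (c k - \<i>)) \<le> 1" for k
    using norm_eigenvalue_minus_i[of k] by (auto simp: norm_divide divide_le_eq_1)
  obtain h where h: "h \<in> sq_integrable M"
    "\<And>g. g \<in> sq_integrable M \<Longrightarrow> (\<lambda>k. 1 / (c k - \<i>) * \<beta> k * sq_inner M (P k) g) sums sq_inner M h g"
    by (rule orthogonal_series[OF P_L2 P_orthogonal bound[of "\<lambda>k. 1 / (c k - \<i>)", OF le1(1)]]) (assumption, rule that)
  obtain v where v: "v \<in> sq_integrable M"
    "\<And>g. g \<in> sq_integrable M \<Longrightarrow> (\<lambda>k. c k / (c k - \<i>) * \<beta> k * sq_inner M (P k) g) sums sq_inner M v g"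
    by (rule orthogonal_series[OF P_L2 P_orthogonal bound[of "\<lambda>k. c k / (c k - \<i>)", OF le1(2)]]) (assumption, rule that)
  have "sq_inner M (T f) h = sq_inner M f v" if f: "f \<in> D_L" for f
  proof -
    note fL2 = Dom_L2[OF DL_Dom[OF f]]
    have "1 / (c k - \<i>) * \<beta> k * sq_inner M (P k) (T f) = c k / (c k - \<i>) * \<beta> k * sq_inner M (P k) f" for k
      using symmetric[OF P f, of k] by (simp add: T_P fL2)
    then have "(\<lambda>k. 1 / (c k - \<i>) * \<beta> k * sq_inner M (P k) (T f)) sums sq_inner M v f"
      using v(2)[OF fL2(1)] by (simp only:)
    with h(2)[OF fL2(2)] have "sq_inner M h (T f) = sq_inner M v f"
      by (rule sums_unique2)
    then show ?thesis
      using sq_inner_commute[of M h "T f"] sq_inner_commute[of M v f] by simp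
  qed
  from adjoint_in_domain[OF h(1) v(1) this] obtain h'
    where h': "h' \<in> D_L" "ae_eq a b h h'" and "ae_eq a b v (T h')" .
  note h'L2 = Dom_L2[OF DL_Dom[OF h'(1)]]
  have coeff: "sq_inner M h' (P j) = \<beta> j / (c j - \<i>) * sq_inner M (P j) (P j)" for j
  proof -
    have "(\<lambda>k. 1 / (c k - \<i>) * \<beta> k * sq_inner M (P k) (P j))
        = (\<lambda>k. if k = j then 1 / (c k - \<i>) * \<beta> k * sq_inner M (P k) (P j) else 0)"
      using P_orthogonal by auto
    moreover have "(\<lambda>k. if k = j then 1 / (c k - \<i>) * \<beta> k * sq_inner M (P k) (P j) else 0)
        sums (1 / (c j - \<i>) * \<beta> j * sq_inner M (P j) (P j))" by (rule sums_single)
    ultimately have "(\<lambda>k. 1 / (c k - \<i>) * \<beta> k * sq_inner M (P k) (P j))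
        sums (1 / (c j - \<i>) * \<beta> j * sq_inner M (P j) (P j))" by simp
    with h(2)[OF P_L2[of j]] have "sq_inner M h (P j) = 1 / (c j - \<i>) * \<beta> j * sq_inner M (P j) (P j)"
      by (rule sums_unique2)
    moreover have "sq_inner M h (P j) = sq_inner M h' (P j)"
      using h'(2) h(1) P_L2 by (intro sq_inner_cong_ae_eq) (auto simp: L2_eq)
    ultimately show ?thesis by simp
  qed
  define z where "z x = 1 * (1 * T h' x + (- \<i>) * h' x) + (-1) * u x" for x
  have Th: "(\<lambda>x. 1 * T h' x + (- \<i>) * h' x) \<in> sq_integrable M"
    by (intro sq_integrable_lincomb h'L2)
  have z: "z \<in> sq_integrable M"
    unfolding z_def by (intro sq_integrable_lincomb Th u)
  have "sq_inner M z (P j) = 0" for j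
  proof -
    have "sq_inner M z (P j) = sq_inner M (T h') (P j) - \<i> * sq_inner M h' (P j) - sq_inner M u (P j)"
      unfolding z_def sq_inner_lincomb_left[OF Th u P_L2] sq_inner_lincomb_left[OF h'L2(2,1) P_L2] by simp
    also have "sq_inner M (T h') (P j) = c j * sq_inner M h' (P j)"
      using symmetric[OF h'(1) P, of j] by (simp add: T_P h'L2 eigenvalue_real)
    also have "c j * sq_inner M h' (P j) - \<i> * sq_inner M h' (P j) = (c j - \<i>) * sq_inner M h' (P j)"
      by (simp add: algebra_simps)
    also have "\<dots> = sq_inner M u (P j)"
      using ne[of j] \<beta>[of j] by (simp add: coeff)
    finally show ?thesis by simp
  qed
  from P_complete[OF z this] have "ae_eq a b (\<lambda>x. T h' x - \<i> * h' x) u"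
    unfolding ae_eq_def z_def by eventually_elim (simp add: algebra_simps)
  with h'(1) show thesis by (rule that)
qed

text \<open>
  If \<open>h\<close> in the domain of \<open>L\<close> solves \<open>(L - \<i>) h = (\<ell> - \<i>) f\<close>, then \<open>f - h\<close> is annihilated by
  \<open>\<ell> - \<i>\<close>.
\<close>
lemma Dom_decomposition:
  assumes f: "f \<in> Dom"
  obtains h where "h \<in> D_L" "(\<lambda>x. f x - h x) \<in> deficiency_space a b p q w n \<i>"
proof -
  have "(\<lambda>x. 1 * T f x + (- \<i>) * f x) \<in> sq_integrable M"
    by (intro sq_integrable_lincomb Dom_L2 f)
  from resolvent[OF this] obtain h where h: "h \<in> D_L"
    and ae: "ae_eq a b (\<lambda>x. T h x - \<i> * h x) (\<lambda>x. 1 * T f x + (- \<i>) * f x)" .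
  have "(\<lambda>x. f x - h x) \<in> Dom" and T: "ae_eq a b (T (\<lambda>x. f x - h x)) (\<lambda>x. T f x - T h x)"
    using Dom_lincomb[OF f DL_Dom[OF h], of 1 "-1"] by simp_all
  moreover have "ae_eq a b (T (\<lambda>x. f x - h x)) (\<lambda>x. \<i> * (f x - h x))"
    using T ae unfolding ae_eq_def
  proof eventually_elim
    case (elim x)
    show ?case
    proof
      assume "x \<in> einterval a b"
      with elim have "T (\<lambda>x. f x - h x) x = T f x - T h x" "T h x - \<i> * h x = 1 * T f x + - \<i> * f x"
        by blast+
      then show "T (\<lambda>x. f x - h x) x = \<i> * (f x - h x)" by algebra
    qed
  qed
  ultimately show thesis using h by (intro that[of h]) (auto simp: deficiency_space_def)
qed

text \<open>
  For \<open>\<ell>[g] = \<i> g\<close> the form is \<open>[g, P k] = (\<i> - c k) \<langle>g, P k\<rangle>\<close>, where \<open>c k\<close> is real.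
\<close>
lemma deficiency_separated:
  assumes n: "n \<ge> 1" and g: "g \<in> deficiency_space a b p q w n \<i>" and br: "\<And>k. bracket g (P k) = 0"
  shows "g = 0"
proof -
  have gD: "g \<in> Dom" and Tg: "ae_eq a b (T g) (\<lambda>x. \<i> * g x)"
    using g by (auto simp: deficiency_space_def)
  have "sq_inner M g (P k) = 0" for k
  proof -
    have "sq_inner M (T g) (P k) = sq_inner M (\<lambda>x. \<i> * g x) (P k)"
      using Tg Dom_L2[OF gD] P_L2 by (intro sq_inner_cong_ae_eq) (auto simp: L2_eq)
    then have "bracket g (P k) = (\<i> - c k) * sq_inner M g (P k)"
      using Dom_L2[OF gD] by (simp add: bracket_eq gD DL_Dom P T_P eigenvalue_real sq_inner_cmult_left P_L2 algebra_simps)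
    moreover have "\<i> - c k \<noteq> 0" using norm_eigenvalue_minus_i(1)[of k] by auto
    ultimately show ?thesis using br[of k] by simp
  qed
  then have "ae_eq a b g (\<lambda>x. 0)" using Dom_L2[OF gD] by (intro P_complete) auto
  moreover have "(\<lambda>x. 0) \<in> Dom" using Dom_lincomb(1)[OF gD gD, of 0 0] by simp
  ultimately have "g = (\<lambda>x. 0)"
    using gD n by (intro sl_dom_eqI[of n g a b p q w]) (auto simp: D_max_def)
  then show ?thesis by (simp add: zero_fun_def)
qed

end

section \<open>Boundary conditions given by eigenfunctions\<close>

theorem theorem5p1:
  fixes a b :: ereal and p q w :: "real \<Rightarrow> real" and n m :: nat
    and D_L :: "(real \<Rightarrow> complex) set" and P :: "nat \<Rightarrow> real \<Rightarrow> complex"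
  assumes "a < b" and "n \<ge> 1"
    and "sl_coefficients a b p q w"
    and "formally_symmetric a b p q w n"
    and "D_L \<subseteq> D_max a b p q w n"
    and "self_adjoint_op a b w (op_of a b w (sl_pow a b p q w n) D_L)"
    and "left_definite_op a b p q w n (op_of a b w (sl_pow a b p q w n) D_L)"
    and "\<And>k. P k \<in> D_L"
    and "\<And>k. \<exists>c. ae_eq a b (sl_pow a b p q w n (P k)) (\<lambda>x. c * P k x)"
    and "complete_orthogonal a b w P"
    and "D_min a b p q w n \<subseteq> D_L"
    and "deficiency_indices a b p q w n m m"
  shows "\<exists>k :: nat \<Rightarrow> nat.
           lin_indep_mod (D_min a b p q w n) m (\<lambda>i. P (k i)) \<and>
           (\<forall>i\<in>{1..m}. \<forall>j\<in>{1..m}. sl_bracket a b p q w n (P (k i)) (P (k j)) = 0) \<and>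
           D_L = {f \<in> D_max a b p q w n. \<forall>i\<in>{1..m}. sl_bracket a b p q w n f (P (k i)) = 0}"
proof -
  obtain c where c: "\<And>k. ae_eq a b (sl_pow a b p q w n (P k)) (\<lambda>x. c k * P k x)"
    using assms(9) by metis
  interpret self_adjoint_realization a b p q w n D_L P c
    by unfold_locales (use assms c in auto)
  define V where "V = deficiency_space a b p q w n \<i>"
  have VD: "g \<in> Dom" if "g \<in> V" for g using that by (simp add: V_def deficiency_space_def)
  have PD: "P k \<in> Dom" for k using P DL_Dom by blast
  obtain B where B: "finite B" "card B = m" "cfun.independent B" "V = cfun.span B"
    using assms(12) unfolding deficiency_indices_def has_cdim_def V_def by metis
  have add: "bracket (x + y) (P k) = bracket x (P k) + bracket y (P k)" if "x \<in> V" "y \<in> V" for k x y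
    using bracket_lincomb_left[OF VD[OF that(1)] VD[OF that(2)] PD[of k], of 1 1] by (simp add: plus_fun_def)
  have mult: "bracket (\<lambda>t. d * x t) (P k) = d * bracket x (P k)" if "x \<in> V" for k d x
    using bracket_lincomb_left[OF VD[OF that] VD[OF that] PD[of k], of d 0] by simp
  have zero: "x = 0" if "x \<in> V" "\<And>k. bracket x (P k) = 0" for x
    using deficiency_separated[OF assms(2)] that by (simp add: V_def)
  have "\<exists>\<kappa>. (\<forall>x\<in>V. (\<forall>i\<in>{1..m}. bracket x (P (\<kappa> i)) = 0) \<longrightarrow> x = 0) \<and>
     (\<forall>\<alpha>. (\<forall>x\<in>V. (\<Sum>i=1..m. \<alpha> i * bracket x (P (\<kappa> i))) = 0) \<longrightarrow> (\<forall>i\<in>{1..m}. \<alpha> i = 0))"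
    by (rule cfun.separating_functionals_select[where \<phi> = "\<lambda>k x. bracket x (P k)", OF B(1,3,2,4)])
      (fact add mult zero)+
  then obtain \<kappa> :: "nat \<Rightarrow> nat"
    where sep: "\<forall>x\<in>V. (\<forall>i\<in>{1..m}. bracket x (P (\<kappa> i)) = 0) \<longrightarrow> x = 0"
      and ind: "\<forall>\<alpha>. (\<forall>x\<in>V. (\<Sum>i=1..m. \<alpha> i * bracket x (P (\<kappa> i))) = 0) \<longrightarrow> (\<forall>i\<in>{1..m}. \<alpha> i = 0)"
    by (elim exE conjE)
  have "lin_indep_mod (D_min a b p q w n) m (\<lambda>i. P (\<kappa> i))"
    unfolding lin_indep_mod_def
  proof (intro allI impI)
    fix \<alpha> :: "nat \<Rightarrow> complex" assume \<alpha>: "(\<lambda>x. \<Sum>i=1..m. \<alpha> i * P (\<kappa> i) x) \<in> D_min a b p q w n"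
    \<comment> \<open>Conjugates appear because the functionals have \<open>P\<close> in the conjugate-linear argument.\<close>
    have "(\<Sum>i=1..m. cnj (\<alpha> i) * bracket g (P (\<kappa> i))) = 0" if "g \<in> V" for g
    proof -
      have "(\<Sum>i=1..m. \<alpha> i * bracket (P (\<kappa> i)) g) = bracket (\<lambda>x. \<Sum>i=1..m. \<alpha> i * P (\<kappa> i) x) g"
        using Dom_sum[of "{1..m}" "\<lambda>i. P (\<kappa> i)" g \<alpha>] PD VD[OF that] by simp
      also have "\<dots> = 0"
        using \<alpha> VD[OF that] by (auto simp: D_min_def)
      finally have "cnj (\<Sum>i=1..m. \<alpha> i * bracket (P (\<kappa> i)) g) = 0" by simp
      then show ?thesis
        by (simp add: bracket_commute[OF PD VD[OF that]] sum_negf)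
    qed
    with ind[rule_format, of "\<lambda>i. cnj (\<alpha> i)"] show "\<forall>i\<in>{1..m}. \<alpha> i = 0" by simp
  qed
  moreover have "D_L = {f \<in> D_max a b p q w n. \<forall>i\<in>{1..m}. bracket f (P (\<kappa> i)) = 0}"
  proof
    show "D_L \<subseteq> {f \<in> D_max a b p q w n. \<forall>i\<in>{1..m}. bracket f (P (\<kappa> i)) = 0}"
      using DL_Dom bracket_D_L P by blast
    show "{f \<in> D_max a b p q w n. \<forall>i\<in>{1..m}. bracket f (P (\<kappa> i)) = 0} \<subseteq> D_L"
    proof clarify
      fix f assume f: "f \<in> Dom" and br: "\<forall>i\<in>{1..m}. bracket f (P (\<kappa> i)) = 0"
      obtain h where h: "h \<in> D_L" "(\<lambda>x. f x - h x) \<in> V"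
        using Dom_decomposition[OF f] unfolding V_def by blast
      have "bracket (\<lambda>x. f x - h x) (P (\<kappa> i)) = 0" if "i \<in> {1..m}" for i
        using bracket_lincomb_left[OF f DL_Dom[OF h(1)] PD[of "\<kappa> i"], of 1 "-1"] br that
          bracket_D_L[OF h(1) P] by simp
      with sep h(2) have "(\<lambda>x. f x - h x) = 0" by blast
      then have "f = h" by (auto simp: fun_eq_iff)
      with h(1) show "f \<in> D_L" by simp
    qed
  qed
  ultimately show ?thesis
    by (blast intro: bracket_D_L P)
qed

end
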